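(* Let $n\ge 2$ be an integer or $n=\infty$, let $\omega\in\Omega_+$ be a periodic word, and let $T=(T_1,\ldots,T_n)$ be the bilateral weighted shift on $\mathcal{K}_\omega$ with weights $\Lambda=\{\lambda_u\}_{u\in\mathbb{F}_\omega}$, all $\lambda_u>0$. The following assertions are equivalent: (i) $\mathfrak{S}_{\omega,\Lambda}$ has non-trivial reducing subspaces. (ii) The weights $\Lambda=\{\lambda_u\}_{u\in\mathbb{F}_\omega}$ are periodic. (iii) The weighted shift $T=(T_1,\ldots,T_n)$ is periodic.
   Context: $\mathbb{F}_n^+$ is the unital free semigroup on the letters $\{1,2,\ldots,n\}$ (on $\{1,2,\ldots\}$ if $n=\infty$), with unit the empty word $\phi$; $|w|$ is the length of $w\in\mathbb{F}_n^+$. $\Omega_+$ is the set of infinite words $\omega=i_1i_2i_3\cdots$ in these letters; $\omega_0=\phi$ and $\omega_m=i_1\cdots i_m$ for $m\ge1$. $\omega$ is periodic if $\omega=v_0v_0v_0\cdots$ for some nonempty $v_0\in\mathbb{F}_n^+$; one takes $v_0$ primitive, i.e. nonempty and not a power (with exponent $\ge2$) of another element of $\mathbb{F}_n^+$. $\mathbb{F}_\omega$ is the set of elements of the free group on the $n$ generators given by reduced words of the form $u=v\omega_m^{-1}$ with $v\in\mathbb{F}_n^+$, $m\ge0$; it is closed under left multiplication by $\mathbb{F}_n^+$. $\mathcal{K}_\omega=\ell^2(\mathbb{F}_\omega)$ has orthonormal basis $\{\xi_u:u\in\mathbb{F}_\omega\}$. The bilateral weighted shift on $\mathcal{K}_\omega$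 with weights $\Lambda$ is the $n$-tuple of (bounded) operators $T=(T_1,\ldots,T_n)$ with $T_i\xi_u=\lambda_{iu}\xi_{iu}$ for $u\in\mathbb{F}_\omega$, $1\le i\le n$. $\mathfrak{S}_{\omega,\Lambda}$ is the unital weak-operator-topology closed (nonselfadjoint) algebra generated by $T_1,\ldots,T_n$. A closed subspace reduces the algebra if its orthogonal projection commutes with every element of the algebra; it is non-trivial if it is neither $\{0\}$ nor $\mathcal{K}_\omega$. Periodicity of weights. Let $\omega=v_0v_0\cdots=i_1i_2\cdots$ with $v_0$ primitive, let $k\ge1$, and put $i_0=i_{|v_0|}$. Define $$\mathbb{F}_{\omega,k}=\{v\omega_m^{-1}: v\in\mathbb{F}_n^+\setminus\mathbb{F}_n^+i_m,\ 0\le m<k|v_0|\},$$ $\mathcal{J}_{\phi,k}=\{(v_0^k)^l:l\in\mathbb{Z}\}$, and $\mathcal{J}_{u,k}=u\mathcal{J}_{\phi,k}$ for $u\in\mathbb{F}_{\omega,k}$ (products in the free group). The sets $\mathcal{J}_{u,k}$, $u\in\mathbb{F}_{\omega,k}$, form a partition of $\mathbb{F}_\omega$. The weights $\Lambda$ are of period $k$, equivalently (by definition) the weighted shift $T$ is of period $k$, if $$T_i\xi_v=\lambda_{iv}\xi_{iv}=\lambda_u\xi_{iv}\quad\text{for all } v\in\mathbb{F}_\omega,\ 1\le i\le n,$$ where $u$ is the unique element of $\mathbb{F}_{\omega,k}$ with $iv\in\mathcal{J}_{u,k}$. The weights (the shift) are periodic if they are of period $k$ for some $k\ge1$. *)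

theory Defs
  imports
    "HOL-Analysis.Analysis"
    "HOL-Algebra.Coset"
    "HOL-Library.Stream"
    "HOL-Library.Extended_Nat"
begin

section \<open>Words and the free group\<close>

text \<open>The case of infinitely many letters is \<^term>\<open>n = \<infinity>\<close>.\<close>

definition letters :: "enat \<Rightarrow> nat set" where
  "letters n = {i. 1 \<le> i \<and> enat i \<le> n}"

abbreviation free_semigroup :: "enat \<Rightarrow> nat list set" where
  "free_semigroup n \<equiv> lists (letters n)"

text \<open>
  An element of the free group is a reduced word in signed letters: \<^term>\<open>(i, True)\<close> is the
  generator \<^term>\<open>i\<close> and \<^term>\<open>(i, False)\<close> its inverse.
\<close>

type_synonym group_word = "(nat \<times> bool) list"

definition inv_letter :: "nat \<times> bool \<Rightarrow> nat \<times> bool" where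
  "inv_letter x = (fst x, \<not> snd x)"

definition reduced_word :: "group_word \<Rightarrow> bool" where
  "reduced_word = successively (\<lambda>x y. y \<noteq> inv_letter x)"

fun cancel_Cons :: "nat \<times> bool \<Rightarrow> group_word \<Rightarrow> group_word" where
  "cancel_Cons x [] = [x]"
| "cancel_Cons x (y # ys) = (if y = inv_letter x then ys else x # y # ys)"

definition free_group :: "enat \<Rightarrow> group_word monoid" where
  "free_group n =
     \<lparr>carrier = {w. reduced_word w \<and> fst ` set w \<subseteq> letters n},
      monoid.mult = (\<lambda>v w. foldr cancel_Cons v w),
      one = []\<rparr>"

definition pos :: "nat list \<Rightarrow> group_word" where
  "pos v = map (\<lambda>i. (i, True)) v"

lemma inv_letter_simps [simp]:
  "inv_letter (inv_letter x) = x" "inv_letter x \<noteq> x" "x \<noteq> inv_letter x"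
  "fst (inv_letter x) = fst x" "inv_letter x = inv_letter y \<longleftrightarrow> x = y"
  by (cases x; cases y; auto simp: inv_letter_def)+

lemma reduced_simps [simp]:
  "reduced_word []" "reduced_word [x]"
  "reduced_word (x # y # ys) \<longleftrightarrow> y \<noteq> inv_letter x \<and> reduced_word (y # ys)"
  by (simp_all add: reduced_word_def)

lemma reduced_ConsD: "reduced_word (x # xs) \<Longrightarrow> reduced_word xs"
  by (cases xs) auto

lemma reduced_cancel_Cons: "reduced_word w \<Longrightarrow> reduced_word (cancel_Cons x w)"
  by (cases w) (auto dest: reduced_ConsD)

lemma set_cancel_Cons: "set (cancel_Cons x w) \<subseteq> insert x (set w)"
  by (cases w) auto

lemma cancel_Cons_inv_letter:
  "reduced_word w \<Longrightarrow> cancel_Cons (inv_letter x) (cancel_Cons x w) = w"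
proof (cases w)
  case (Cons y ys)
  then show "reduced_word w \<Longrightarrow> ?thesis" by (cases ys) auto
qed simp

lemma reduced_foldr: "reduced_word w \<Longrightarrow> reduced_word (foldr cancel_Cons v w)"
  by (induction v) (auto simp: reduced_cancel_Cons)

lemma set_foldr: "set (foldr cancel_Cons v w) \<subseteq> set v \<union> set w"
proof (induction v)
  case (Cons x v)
  then show ?case using set_cancel_Cons[of x "foldr cancel_Cons v w"] by auto
qed simp

lemma foldr_cancel_Cons:
  assumes "reduced_word z"
  shows "foldr cancel_Cons (cancel_Cons x v) z = cancel_Cons x (foldr cancel_Cons v z)"
proof (cases v)
  case (Cons y ys)
  then show ?thesis
    using cancel_Cons_inv_letter[of "foldr cancel_Cons ys z" "inv_letter x"]
    by (simp add: assms reduced_foldr)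
qed simp

lemma foldr_assoc:
  "reduced_word z \<Longrightarrow>
    foldr cancel_Cons (foldr cancel_Cons u v) z = foldr cancel_Cons u (foldr cancel_Cons v z)"
  by (induction u) (auto simp: foldr_cancel_Cons)

lemma foldr_Nil: "reduced_word v \<Longrightarrow> foldr cancel_Cons v [] = v"
proof (induction v)
  case (Cons x v)
  then show ?case by (cases v) auto
qed simp

lemma foldr_inverse:
  "reduced_word w \<Longrightarrow> foldr cancel_Cons (map inv_letter (rev v)) (foldr cancel_Cons v w) = w"
  by (induction v arbitrary: w) (auto simp: cancel_Cons_inv_letter reduced_foldr)

lemma reduced_inverse: "reduced_word v \<Longrightarrow> reduced_word (map inv_letter (rev v))"
  unfolding reduced_word_def successively_map successively_rev
  by (erule successively_mono) auto

lemma group_free_group: "group (free_group n)"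
proof (rule groupI)
  fix x y assume "x \<in> carrier (free_group n)" "y \<in> carrier (free_group n)"
  then show "x \<otimes>\<^bsub>free_group n\<^esub> y \<in> carrier (free_group n)"
    using set_foldr[of x y] by (fastforce simp: free_group_def reduced_foldr)
next
  fix x assume x: "x \<in> carrier (free_group n)"
  then have "foldr cancel_Cons (map inv_letter (rev x)) x = []"
    using foldr_inverse[of "[]" x] by (simp add: free_group_def foldr_Nil)
  moreover have "map inv_letter (rev x) \<in> carrier (free_group n)"
    using x by (force simp: free_group_def reduced_inverse)
  ultimately show "\<exists>y\<in>carrier (free_group n). y \<otimes>\<^bsub>free_group n\<^esub> x = \<one>\<^bsub>free_group n\<^esub>"
    by (intro bexI[of _ "map inv_letter (rev x)"]) (simp_all add: free_group_def)
qed (auto simp: free_group_def foldr_assoc)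

section \<open>Infinite words\<close>

text \<open>\<^term>\<open>stake m \<omega>\<close> is the prefix \<open>\<omega>\<^sub>m\<close>; note that \<^term>\<open>\<omega> !! 0\<close> is the letter \<open>i\<^sub>1\<close>.\<close>

definition periodic_word :: "enat \<Rightarrow> nat stream \<Rightarrow> bool" where
  "periodic_word n \<omega> \<longleftrightarrow> (\<exists>v\<in>free_semigroup n. v \<noteq> [] \<and> \<omega> = cycle v)"

definition primitive :: "enat \<Rightarrow> nat list \<Rightarrow> bool" where
  "primitive n v \<longleftrightarrow>
     v \<in> free_semigroup n \<and> v \<noteq> [] \<and>
     \<not> (\<exists>u\<in>free_semigroup n. \<exists>k\<ge>2. v = concat (replicate k u))"

text \<open>
  If the last letter of \<open>v\<close> is \<open>i\<^sub>m\<close>, then \<open>v \<omega>\<^sub>m\<inverse>\<close> cancels to a product of the same form.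
  Hence the set of all these products in the free group coincides with the set of group elements
  whose reduced word has this form.
\<close>

definition F_omega :: "enat \<Rightarrow> nat stream \<Rightarrow> group_word set" where
  "F_omega n \<omega> =
     {pos v \<otimes>\<^bsub>free_group n\<^esub> inv\<^bsub>free_group n\<^esub> pos (stake m \<omega>) | v m. v \<in> free_semigroup n}"

definition lmul :: "enat \<Rightarrow> nat \<Rightarrow> group_word \<Rightarrow> group_word" where
  "lmul n i u = pos [i] \<otimes>\<^bsub>free_group n\<^esub> u"

section \<open>The Hilbert space and its operators\<close>

text \<open>
  Vectors of \<open>\<ell>\<^sup>2(S)\<close> are complex functions on the ambient type that vanish off \<open>S\<close>.
\<close>

definition ell2 :: "'g set \<Rightarrow> ('g \<Rightarrow> complex) set" where
  "ell2 S = {f. (\<forall>u. u \<notin> S \<longrightarrow> f u = 0) \<and> (\<lambda>u. (cmod (f u))\<^sup>2) summable_on S}"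

definition l2_inner :: "('g \<Rightarrow> complex) \<Rightarrow> ('g \<Rightarrow> complex) \<Rightarrow> complex" where
  "l2_inner f g = (\<Sum>\<^sub>\<infinity>u. f u * cnj (g u))"

definition l2_norm :: "('g \<Rightarrow> complex) \<Rightarrow> real" where
  "l2_norm f = sqrt (\<Sum>\<^sub>\<infinity>u. (cmod (f u))\<^sup>2)"

definition ket :: "'g \<Rightarrow> 'g \<Rightarrow> complex" where
  "ket u = (\<lambda>x. if x = u then 1 else 0)"

type_synonym 'g operator = "('g \<Rightarrow> complex) \<Rightarrow> ('g \<Rightarrow> complex)"

text \<open>Operators are normalised to be zero outside \<^term>\<open>ell2 S\<close>, so that equality of operators is
  equality of functions.\<close>

definition bounded_ops :: "'g set \<Rightarrow> 'g operator set" where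
  "bounded_ops S = {A.
     (\<forall>f. f \<notin> ell2 S \<longrightarrow> A f = (\<lambda>_. 0)) \<and>
     (\<forall>f\<in>ell2 S. A f \<in> ell2 S) \<and>
     (\<forall>f\<in>ell2 S. \<forall>g\<in>ell2 S. A (\<lambda>u. f u + g u) = (\<lambda>u. A f u + A g u)) \<and>
     (\<forall>c. \<forall>f\<in>ell2 S. A (\<lambda>u. c * f u) = (\<lambda>u. c * A f u)) \<and>
     (\<exists>C. \<forall>f\<in>ell2 S. l2_norm (A f) \<le> C * l2_norm f)}"

definition id_op :: "'g set \<Rightarrow> 'g operator" where
  "id_op S = (\<lambda>f. if f \<in> ell2 S then f else (\<lambda>_. 0))"

text \<open>The coarsest topology on the bounded operators for which all maps
  \<open>A \<mapsto> \<langle>A f, g\<rangle>\<close> are continuous.\<close>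

definition wot :: "'g set \<Rightarrow> 'g operator topology" where
  "wot S = topology_generated_by
     {{A \<in> bounded_ops S. l2_inner (A f) g \<in> U} | f g U. f \<in> ell2 S \<and> g \<in> ell2 S \<and> open U}"

definition unital_subalgebra :: "'g set \<Rightarrow> 'g operator set \<Rightarrow> bool" where
  "unital_subalgebra S \<A> \<longleftrightarrow>
     \<A> \<subseteq> bounded_ops S \<and> id_op S \<in> \<A> \<and>
     (\<forall>A\<in>\<A>. \<forall>B\<in>\<A>. (\<lambda>f u. A f u + B f u) \<in> \<A>) \<and>
     (\<forall>c. \<forall>A\<in>\<A>. (\<lambda>f u. c * A f u) \<in> \<A>) \<and>
     (\<forall>A\<in>\<A>. \<forall>B\<in>\<A>. A \<circ> B \<in> \<A>)"

definition wot_algebra :: "'g set \<Rightarrow> 'g operator set \<Rightarrow> 'g operator set" where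
  "wot_algebra S \<T> = (\<lambda>\<A>. unital_subalgebra S \<A> \<and> closedin (wot S) \<A>) hull \<T>"

definition closed_subspace :: "'g set \<Rightarrow> ('g \<Rightarrow> complex) set \<Rightarrow> bool" where
  "closed_subspace S M \<longleftrightarrow>
     M \<subseteq> ell2 S \<and> (\<lambda>_. 0) \<in> M \<and>
     (\<forall>f\<in>M. \<forall>g\<in>M. (\<lambda>u. f u + g u) \<in> M) \<and>
     (\<forall>c. \<forall>f\<in>M. (\<lambda>u. c * f u) \<in> M) \<and>
     (\<forall>F. \<forall>f\<in>ell2 S. (\<forall>j::nat. F j \<in> M) \<and> (\<lambda>j. l2_norm (\<lambda>u. F j u - f u)) \<longlonglongrightarrow> 0 \<longrightarrow> f \<in> M)"

definition orth_proj :: "('g \<Rightarrow> complex) set \<Rightarrow> 'g operator" where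
  "orth_proj M f = (THE p. p \<in> M \<and> (\<forall>g\<in>M. l2_inner (\<lambda>u. f u - p u) g = 0))"

definition reduces :: "'g set \<Rightarrow> ('g \<Rightarrow> complex) set \<Rightarrow> 'g operator set \<Rightarrow> bool" where
  "reduces S M \<A> \<longleftrightarrow>
     closed_subspace S M \<and> (\<forall>A\<in>\<A>. \<forall>f\<in>ell2 S. orth_proj M (A f) = A (orth_proj M f))"

definition has_nontrivial_reducing_subspace :: "'g set \<Rightarrow> 'g operator set \<Rightarrow> bool" where
  "has_nontrivial_reducing_subspace S \<A> \<longleftrightarrow>
     (\<exists>M. reduces S M \<A> \<and> M \<noteq> {\<lambda>_. 0} \<and> M \<noteq> ell2 S)"

section \<open>Bilateral weighted shifts\<close>

text \<open>The basis vectors determine a bounded operator, so for given weights there is at most one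
  such tuple; it exists precisely when, for each \<open>i\<close>, the weights \<open>\<lambda>\<^bsub>iu\<^esub>\<close> are bounded.\<close>

definition weighted_shift ::
    "enat \<Rightarrow> nat stream \<Rightarrow> (group_word \<Rightarrow> real) \<Rightarrow> (nat \<Rightarrow> group_word operator) \<Rightarrow> bool" where
  "weighted_shift n \<omega> \<Lambda> T \<longleftrightarrow>
     (\<forall>i\<in>letters n. T i \<in> bounded_ops (F_omega n \<omega>) \<and>
       (\<forall>u\<in>F_omega n \<omega>. T i (ket u) = (\<lambda>x. of_real (\<Lambda> (lmul n i u)) * ket (lmul n i u) x)))"

definition shift_algebra ::
    "enat \<Rightarrow> nat stream \<Rightarrow> (nat \<Rightarrow> group_word operator) \<Rightarrow> group_word operator set" where
  "shift_algebra n \<omega> T = wot_algebra (F_omega n \<omega>) (T ` letters n)"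

definition cyc_letter :: "nat stream \<Rightarrow> nat list \<Rightarrow> nat \<Rightarrow> nat" where
  "cyc_letter \<omega> v0 m = \<omega> !! ((if m = 0 then length v0 else m) - 1)"

definition F_period :: "enat \<Rightarrow> nat stream \<Rightarrow> nat list \<Rightarrow> nat \<Rightarrow> group_word set" where
  "F_period n \<omega> v0 k =
     {pos v \<otimes>\<^bsub>free_group n\<^esub> inv\<^bsub>free_group n\<^esub> pos (stake m \<omega>) | v m.
        v \<in> free_semigroup n - {w @ [cyc_letter \<omega> v0 m] | w. w \<in> free_semigroup n} \<and>
        m < k * length v0}"

definition J_phi :: "enat \<Rightarrow> nat list \<Rightarrow> nat \<Rightarrow> group_word set" where
  "J_phi n v0 k =
     {(pos v0 [^]\<^bsub>free_group n\<^esub> k) [^]\<^bsub>free_group n\<^esub> l | l::int. True}"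

definition J_block :: "enat \<Rightarrow> nat list \<Rightarrow> nat \<Rightarrow> group_word \<Rightarrow> group_word set" where
  "J_block n v0 k u = u <#\<^bsub>free_group n\<^esub> J_phi n v0 k"

definition block_rep ::
    "enat \<Rightarrow> nat stream \<Rightarrow> nat list \<Rightarrow> nat \<Rightarrow> group_word \<Rightarrow> group_word" where
  "block_rep n \<omega> v0 k x = (THE u. u \<in> F_period n \<omega> v0 k \<and> x \<in> J_block n v0 k u)"

definition weights_of_period ::
    "enat \<Rightarrow> nat stream \<Rightarrow> nat list \<Rightarrow> nat \<Rightarrow> (group_word \<Rightarrow> real) \<Rightarrow> bool" where
  "weights_of_period n \<omega> v0 k \<Lambda> \<longleftrightarrow>
     (\<forall>v\<in>F_omega n \<omega>. \<forall>i\<in>letters n.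
        \<Lambda> (lmul n i v) = \<Lambda> (block_rep n \<omega> v0 k (lmul n i v)))"

definition shift_of_period ::
    "enat \<Rightarrow> nat stream \<Rightarrow> nat list \<Rightarrow> nat \<Rightarrow> (group_word \<Rightarrow> real) \<Rightarrow>
      (nat \<Rightarrow> group_word operator) \<Rightarrow> bool" where
  "shift_of_period n \<omega> v0 k \<Lambda> T \<longleftrightarrow>
     (\<forall>v\<in>F_omega n \<omega>. \<forall>i\<in>letters n.
        T i (ket v) =
          (\<lambda>x. of_real (\<Lambda> (block_rep n \<omega> v0 k (lmul n i v))) * ket (lmul n i v) x))"

text \<open>The primitive word \<open>v0\<close> with \<^term>\<open>\<omega> = cycle v0\<close> is unique.\<close>

definition weights_periodic :: "enat \<Rightarrow> nat stream \<Rightarrow> (group_word \<Rightarrow> real) \<Rightarrow> bool" where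
  "weights_periodic n \<omega> \<Lambda> \<longleftrightarrow>
     (\<exists>v0 k. primitive n v0 \<and> \<omega> = cycle v0 \<and> 1 \<le> k \<and> weights_of_period n \<omega> v0 k \<Lambda>)"

definition shift_periodic ::
    "enat \<Rightarrow> nat stream \<Rightarrow> (group_word \<Rightarrow> real) \<Rightarrow> (nat \<Rightarrow> group_word operator) \<Rightarrow> bool" where
  "shift_periodic n \<omega> \<Lambda> T \<longleftrightarrow>
     (\<exists>v0 k. primitive n v0 \<and> \<omega> = cycle v0 \<and> 1 \<le> k \<and> shift_of_period n \<omega> v0 k \<Lambda> T)"

end

theory Submission
  imports Defs "HOL-Real_Asymp.Real_Asymp"
begin

text \<open>
  Let \<open>P\<close> be the projection onto a reducing subspace and put \<open>p(u,v) = \<langle>P \<xi>\<^sub>v, \<xi>\<^sub>u\<rangle>\<close>.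
  Commutation with the shifts and self-adjointness give \<open>p(iu,iv) = p(u,v)\<close>, and
  \<open>\<lambda>\<^bsub>iu\<^esub> = \<lambda>\<^bsub>iv\<^esub>\<close> whenever \<open>p(u,v) \<noteq> 0\<close>; moreover \<open>p(u,iv) = 0\<close> unless \<open>u\<close> is of the form
  \<open>iu'\<close>. If \<open>p\<close> is diagonal, it is constant on the diagonal because \<open>\<bbbF>\<^sub>\<omega>\<close> is a tree without
  root in which any two vertices have a common ancestor, so \<open>P\<close> is trivial. Otherwise, going back
  to common ancestors yields \<open>p(\<omega>\<^sub>a\<inverse>, \<omega>\<^sub>b\<inverse>) \<noteq> 0\<close> for some \<open>a < b\<close>, and then
  \<open>p(x\<omega>\<^bsub>a+j\<^esub>\<inverse>, x\<omega>\<^bsub>b+j\<^esub>\<inverse>) \<noteq> 0\<close> for all \<open>x\<close> and \<open>j\<close>; so the weights are invariant under a shift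
  by \<open>b - a\<close>, hence under one by \<open>(b - a)|v\<^sub>0|\<close>, which is periodicity with \<open>k = b - a\<close>.

  Conversely, if the weights have period \<open>k\<close>, right multiplication by \<open>v\<^sub>0\<^sup>k\<close> is a free action of
  the integers on \<open>\<bbbF>\<^sub>\<omega>\<close> that commutes with the shifts, and the spectral subspace of this unitary
  for a half circle reduces the algebra. Concretely it is the orthogonal complement of the
  translates along the orbits of a sequence \<open>d\<close>, and it is nonzero as the translates of a second
  sequence \<open>c\<close> are orthogonal to those of \<open>d\<close>.
\<close>

section \<open>Square-summable functions\<close>

text \<open>\<open>l2_inner\<close> and \<open>l2_norm\<close> sum over the whole type, so
  summability over \<open>S\<close> is traded for summability over \<open>UNIV\<close>; the terms
  off \<open>S\<close> are zero.\<close>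

lemma ell2_iff:
  "f \<in> ell2 S \<longleftrightarrow> (\<forall>u. u \<notin> S \<longrightarrow> f u = 0) \<and> (\<lambda>u. (cmod (f u))\<^sup>2) summable_on UNIV"
proof -
  have "(\<lambda>u. (cmod (f u))\<^sup>2) summable_on S \<longleftrightarrow> (\<lambda>u. (cmod (f u))\<^sup>2) summable_on UNIV"
    if "\<forall>u. u \<notin> S \<longrightarrow> f u = 0"
    using that by (intro summable_on_cong_neutral) auto
  then show ?thesis by (auto simp: ell2_def)
qed

lemma ell2_summable: "f \<in> ell2 S \<Longrightarrow> (\<lambda>u. (cmod (f u))\<^sup>2) summable_on UNIV"
  by (simp add: ell2_iff)

lemma ell2_zero_outside: "f \<in> ell2 S \<Longrightarrow> u \<notin> S \<Longrightarrow> f u = 0"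
  by (simp add: ell2_iff)

lemma ell2_I:
  assumes "\<And>u. u \<notin> S \<Longrightarrow> f u = 0" "g summable_on UNIV" "\<And>u. (cmod (f u))\<^sup>2 \<le> g u"
  shows "f \<in> ell2 S"
  using assms by (auto simp: ell2_iff intro: summable_on_comparison_test)

lemma ell2_zero [simp]: "(\<lambda>_. 0) \<in> ell2 S"
  by (simp add: ell2_iff)

lemma ell2_scale: "f \<in> ell2 S \<Longrightarrow> (\<lambda>u. c * f u) \<in> ell2 S"
  by (auto simp: ell2_iff norm_mult power_mult_distrib intro: summable_on_cmult_right)

lemma ell2_uminus: "f \<in> ell2 S \<Longrightarrow> (\<lambda>u. - f u) \<in> ell2 S"
  by (auto simp: ell2_iff)

lemma cmod_add_square_le: "(cmod (a + b))\<^sup>2 \<le> 2 * (cmod a)\<^sup>2 + 2 * (cmod b)\<^sup>2"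
proof -
  have "(cmod (a + b))\<^sup>2 \<le> (cmod a + cmod b)\<^sup>2"
    by (intro power_mono norm_triangle_ineq) auto
  also have "\<dots> \<le> 2 * (cmod a)\<^sup>2 + 2 * (cmod b)\<^sup>2"
    using sum_squares_ge_zero[of "cmod a - cmod b" 0] by (simp add: power2_eq_square algebra_simps)
  finally show ?thesis .
qed

lemma ell2_add:
  assumes "f \<in> ell2 S" "g \<in> ell2 S"
  shows "(\<lambda>u. f u + g u) \<in> ell2 S"
proof (rule ell2_I)
  show "(\<lambda>u. 2 * (cmod (f u))\<^sup>2 + 2 * (cmod (g u))\<^sup>2) summable_on UNIV"
    using assms by (intro summable_on_add summable_on_cmult_right ell2_summable)
qed (use assms cmod_add_square_le in \<open>auto simp: ell2_iff\<close>)

lemma ell2_diff: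
  assumes "f \<in> ell2 S" "g \<in> ell2 S"
  shows "(\<lambda>u. f u - g u) \<in> ell2 S"
  using ell2_add[OF assms(1) ell2_uminus[OF assms(2)]] by simp

lemma ket_apply: "ket u x = (if x = u then 1 else 0)"
  by (simp add: ket_def)

lemma ket_in_ell2: "u \<in> S \<Longrightarrow> ket u \<in> ell2 S"
  unfolding ell2_iff ket_def
  by (auto intro!: finite_nonzero_values_imp_summable_on finite_subset[of _ "{u}"] split: if_splits)

lemma l2_inner_summable:
  assumes "f \<in> ell2 S" "g \<in> ell2 S"
  shows "(\<lambda>u. f u * cnj (g u)) summable_on UNIV"
proof -
  have "(\<lambda>u. (cmod (f u))\<^sup>2 + (cmod (g u))\<^sup>2) summable_on UNIV"
    using assms by (simp add: summable_on_add ell2_summable)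
  moreover have "norm (f u * cnj (g u)) \<le> (cmod (f u))\<^sup>2 + (cmod (g u))\<^sup>2" for u
    using sum_squares_bound[of "cmod (f u)" "cmod (g u)"]
      mult_nonneg_nonneg[OF norm_ge_zero norm_ge_zero, of "f u" "g u"]
    unfolding norm_mult complex_mod_cnj by linarith
  ultimately have "(\<lambda>u. norm (f u * cnj (g u))) summable_on UNIV"
    by (rule summable_on_comparison_test) auto
  then show ?thesis by (rule abs_summable_summable)
qed

lemma l2_inner_add:
  assumes "f \<in> ell2 S" "g \<in> ell2 S" "h \<in> ell2 S"
  shows "l2_inner (\<lambda>u. f u + g u) h = l2_inner f h + l2_inner g h"
  unfolding l2_inner_def
  by (subst infsum_add[symmetric]) (use assms in \<open>auto intro: l2_inner_summable simp: algebra_simps\<close>)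

lemma l2_inner_scale: "l2_inner (\<lambda>u. c * f u) h = c * l2_inner f h"
  unfolding l2_inner_def by (simp add: infsum_cmult_right' mult.assoc)

lemma l2_inner_diff:
  assumes "f \<in> ell2 S" "g \<in> ell2 S" "h \<in> ell2 S"
  shows "l2_inner (\<lambda>u. f u - g u) h = l2_inner f h - l2_inner g h"
  using l2_inner_add[OF assms(1) ell2_scale[OF assms(2)] assms(3), of "-1"]
    l2_inner_scale[of "-1" g h] by simp

lemma l2_inner_commute: "l2_inner g f = cnj (l2_inner f g)"
  unfolding l2_inner_def by (simp flip: infsum_cnj add: mult.commute)

lemma l2_norm_square: "(l2_norm f)\<^sup>2 = (\<Sum>\<^sub>\<infinity>u. (cmod (f u))\<^sup>2)"
  unfolding l2_norm_def by (simp add: infsum_nonneg)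

lemma l2_norm_nonneg [simp]: "0 \<le> l2_norm f"
  unfolding l2_norm_def by (simp add: infsum_nonneg)

lemma l2_inner_self:
  assumes "f \<in> ell2 S"
  shows "l2_inner f f = of_real ((l2_norm f)\<^sup>2)"
proof -
  have "l2_inner f f = (\<Sum>\<^sub>\<infinity>u. of_real ((cmod (f u))\<^sup>2))"
    unfolding l2_inner_def by (simp only: complex_norm_square)
  also have "\<dots> = of_real ((l2_norm f)\<^sup>2)"
    unfolding l2_norm_square
    by (intro infsumI has_sum_of_real has_sum_infsum ell2_summable[OF assms])
  finally show ?thesis .
qed

lemma l2_inner_ket: "l2_inner f (ket u) = f u"
proof -
  have "l2_inner f (ket u) = (\<Sum>\<^sub>\<infinity>x\<in>{u}. f x * cnj (ket u x))"
    unfolding l2_inner_def by (rule infsum_cong_neutral) (auto simp: ket_def)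
  then show ?thesis by (simp add: ket_def)
qed

lemma finite_sum_le_l2_norm:
  assumes "f \<in> ell2 S" "finite F"
  shows "(\<Sum>u\<in>F. (cmod (f u))\<^sup>2) \<le> (l2_norm f)\<^sup>2"
  unfolding l2_norm_square using assms by (intro finite_sum_le_infsum ell2_summable) auto

lemma cmod_le_l2_norm:
  assumes "f \<in> ell2 S"
  shows "cmod (f u) \<le> l2_norm f"
  using finite_sum_le_l2_norm[OF assms, of "{u}"] by (simp add: power2_le_iff_abs_le)

text \<open>Plays the role of Fatou's lemma: a bound on all finite partial sums survives a
  coordinatewise limit, which is how limits of vectors are controlled below.\<close>

lemma l2_norm_le_finite_sums:
  assumes "\<And>u. u \<notin> S \<Longrightarrow> f u = 0" "\<And>F. finite F \<Longrightarrow> (\<Sum>u\<in>F. (cmod (f u))\<^sup>2) \<le> B"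
  shows "f \<in> ell2 S" "(l2_norm f)\<^sup>2 \<le> B"
proof -
  have summ: "(\<lambda>u. (cmod (f u))\<^sup>2) summable_on UNIV"
    using assms(2) by (intro nonneg_bdd_above_summable_on) (auto intro!: bdd_aboveI2)
  then show "f \<in> ell2 S" using assms(1) by (simp add: ell2_iff)
  show "(l2_norm f)\<^sup>2 \<le> B"
    unfolding l2_norm_square using summ assms(2) by (intro infsum_le_finite_sums) auto
qed

lemma l2_norm_zero_imp: "f \<in> ell2 S \<Longrightarrow> l2_norm f = 0 \<Longrightarrow> f = (\<lambda>_. 0)"
  using cmod_le_l2_norm[of f S] by auto

lemma l2_norm_diff_square:
  assumes "f \<in> ell2 S" "g \<in> ell2 S"
  shows "(l2_norm (\<lambda>u. f u - c * g u))\<^sup>2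
    = (l2_norm f)\<^sup>2 - 2 * Re (cnj c * l2_inner f g) + (cmod c)\<^sup>2 * (l2_norm g)\<^sup>2"
proof -
  let ?h = "\<lambda>u. f u - c * g u"
  have cg: "(\<lambda>u. c * g u) \<in> ell2 S" and h: "?h \<in> ell2 S"
    using assms by (auto intro: ell2_scale ell2_diff)
  note self = assms[THEN l2_inner_self] l2_inner_self[OF h]
  have fh: "l2_inner f ?h = of_real ((l2_norm f)\<^sup>2) - cnj c * l2_inner f g"
    using l2_inner_diff[OF assms(1) cg assms(1)] l2_inner_commute[of f ?h]
      l2_inner_commute[of f g]
    by (simp add: self l2_inner_scale)
  have gh: "l2_inner g ?h = l2_inner g f - cnj c * of_real ((l2_norm g)\<^sup>2)"
    using l2_inner_diff[OF assms(1) cg assms(2)] l2_inner_commute[of g ?h]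
      l2_inner_commute[of f g]
    by (simp add: self l2_inner_scale)
  have "of_real ((l2_norm ?h)\<^sup>2) = l2_inner f ?h - c * l2_inner g ?h"
    using l2_inner_diff[OF assms(1) cg h] by (simp add: self l2_inner_scale)
  also have "\<dots> = of_real ((l2_norm f)\<^sup>2) - (cnj c * l2_inner f g + cnj (cnj c * l2_inner f g))
      + of_real ((cmod c)\<^sup>2) * of_real ((l2_norm g)\<^sup>2)"
    unfolding fh gh l2_inner_commute[of g f] complex_norm_square by (simp add: algebra_simps)
  finally have "Re (of_real ((l2_norm ?h)\<^sup>2)) = Re \<dots>" by simp
  then show ?thesis by simp
qed

text \<open>The parallelogram law for \<open>f - g\<close> and \<open>f - h\<close>, written with
  the midpoint of \<open>g\<close> and \<open>h\<close>, as minimizing sequences require. It is an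
  identity of complex numbers summed over the coordinates.\<close>

lemma l2_norm_parallelogram:
  assumes "f \<in> ell2 S" "g \<in> ell2 S" "h \<in> ell2 S"
  shows "(l2_norm (\<lambda>u. g u - h u))\<^sup>2 + 4 * (l2_norm (\<lambda>u. f u - (1/2) * (g u + h u)))\<^sup>2
    = 2 * (l2_norm (\<lambda>u. f u - g u))\<^sup>2 + 2 * (l2_norm (\<lambda>u. f u - h u))\<^sup>2"
proof -
  have eq: "(cmod (b - c))\<^sup>2 + 4 * (cmod (a - (1/2) * (b + c)))\<^sup>2
    = 2 * (cmod (a - b))\<^sup>2 + 2 * (cmod (a - c))\<^sup>2" for a b c
    unfolding cmod_power2 by (simp add: power2_eq_square field_simps)
  have mid: "(\<lambda>u. f u - (1/2) * (g u + h u)) \<in> ell2 S"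
    using assms by (intro ell2_diff ell2_scale ell2_add)
  note summ = assms[THEN ell2_summable] mid[THEN ell2_summable]
    ell2_diff[OF assms(2,3), THEN ell2_summable]
    ell2_diff[OF assms(1,2), THEN ell2_summable] ell2_diff[OF assms(1,3), THEN ell2_summable]
  have "(\<Sum>\<^sub>\<infinity>u. (cmod (g u - h u))\<^sup>2) + (\<Sum>\<^sub>\<infinity>u. 4 * (cmod (f u - (1/2) * (g u + h u)))\<^sup>2)
    = (\<Sum>\<^sub>\<infinity>u. 2 * (cmod (f u - g u))\<^sup>2) + (\<Sum>\<^sub>\<infinity>u. 2 * (cmod (f u - h u))\<^sup>2)"
    using summ by (subst (1 2) infsum_add[symmetric]) (simp_all only: eq summable_on_cmult_right)
  then show ?thesis
    unfolding l2_norm_square by (simp only: infsum_cmult_right')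
qed

section \<open>Orthogonal projections and their commutants\<close>

lemma closed_subspaceD:
  assumes "closed_subspace S M"
  shows "f \<in> M \<Longrightarrow> f \<in> ell2 S" "(\<lambda>_. 0) \<in> M"
    "f \<in> M \<Longrightarrow> g \<in> M \<Longrightarrow> (\<lambda>u. f u + g u) \<in> M"
    "f \<in> M \<Longrightarrow> (\<lambda>u. c * f u) \<in> M"
    "f \<in> M \<Longrightarrow> g \<in> M \<Longrightarrow> (\<lambda>u. f u - g u) \<in> M"
proof -
  have add: "f \<in> M \<Longrightarrow> g \<in> M \<Longrightarrow> (\<lambda>u. f u + g u) \<in> M"
    and scale: "f \<in> M \<Longrightarrow> (\<lambda>u. c * f u) \<in> M" for f g c
    using assms by (auto simp: closed_subspace_def)
  show "f \<in> M \<Longrightarrow> g \<in> M \<Longrightarrow> (\<lambda>u. f u - g u) \<in> M"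
    using add[OF _ scale[of g "-1"], of f] by simp
qed (use assms in \<open>auto simp: closed_subspace_def\<close>)

lemma closed_subspace_limit:
  assumes "closed_subspace S M" "f \<in> ell2 S" "\<And>j::nat. F j \<in> M"
    "(\<lambda>j. l2_norm (\<lambda>u. F j u - f u)) \<longlonglongrightarrow> 0"
  shows "f \<in> M"
  using assms unfolding closed_subspace_def by blast

text \<open>A minimizing sequence for the distance from \<open>f\<close> to \<open>M\<close> is
  Cauchy by the parallelogram law. Its coordinatewise limit lies in \<open>M\<close> and attains the
  distance, and a first variation then gives orthogonality.\<close>

lemma projection_theorem:
  assumes M: "closed_subspace S M" and f: "f \<in> ell2 S"
  obtains p where "p \<in> M" "\<And>g. g \<in> M \<Longrightarrow> l2_inner (\<lambda>u. f u - p u) g = 0"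
proof -
  define N where "N g = (l2_norm (\<lambda>u. f u - g u))\<^sup>2" for g
  define d where "d = Inf (N ` M)"
  have bdd: "bdd_below (N ` M)" by (rule bdd_belowI2[of _ 0]) (simp add: N_def)
  have d_le: "d \<le> N g" if "g \<in> M" for g
    unfolding d_def using bdd that by (intro cInf_lower) auto
  have "\<exists>g\<in>M. N g < d + 1 / real (Suc j)" for j
  proof -
    have "Inf (N ` M) < d + 1 / real (Suc j)" unfolding d_def by simp
    then show ?thesis
      using bdd closed_subspaceD(2)[OF M] by (subst (asm) cInf_less_iff) auto
  qed
  then obtain F where FM: "\<And>j. F j \<in> M" and NF: "\<And>j. N (F j) < d + 1 / real (Suc j)"
    by metis
  have Fl: "F j \<in> ell2 S" for j using closed_subspaceD(1)[OF M FM] .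
  \<comment> \<open>The midpoint of \<open>F i\<close> and \<open>F j\<close> lies in
    \<open>M\<close>, so its squared distance to \<open>f\<close> is at least \<open>d\<close>; the
    excesses over \<open>d\<close> of the two terms bound their mutual distance.\<close>
  have dist: "(l2_norm (\<lambda>u. F i u - F j u))\<^sup>2 \<le> 2 / real (Suc i) + 2 / real (Suc j)" for i j
  proof -
    have "(\<lambda>u. (1/2) * (F i u + F j u)) \<in> M"
      by (intro closed_subspaceD(3,4)[OF M] FM)
    then have "d \<le> N (\<lambda>u. (1/2) * (F i u + F j u))" by (rule d_le)
    then show ?thesis
      using l2_norm_parallelogram[OF f Fl[of i] Fl[of j]] NF[of i] NF[of j]
      unfolding N_def by simp
  qed
  have "Cauchy (\<lambda>j. F j u)" for u
  proof (rule CauchyI)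
    fix e :: real assume "0 < e"
    then obtain n where n: "4 / e\<^sup>2 < real (Suc n)"
      by (meson less_SucI reals_Archimedean2 order_less_trans of_nat_less_iff lessI)
    have "norm (F i u - F j u) < e" if "i \<ge> n" "j \<ge> n" for i j
    proof -
      have "(norm (F i u - F j u))\<^sup>2 \<le> (l2_norm (\<lambda>u. F i u - F j u))\<^sup>2"
        by (rule power_mono[OF cmod_le_l2_norm[OF ell2_diff[OF Fl Fl]]]) simp
      also have "\<dots> \<le> 2 / real (Suc n) + 2 / real (Suc n)"
        by (rule order_trans[OF dist]) (use that in \<open>intro add_mono divide_left_mono, auto\<close>)
      also have "\<dots> = 4 / real (Suc n)" by (simp flip: add_divide_distrib del: of_nat_Suc)
      also have "\<dots> < e\<^sup>2" using n \<open>0 < e\<close> by (simp add: field_simps del: of_nat_Suc)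
      finally show ?thesis using \<open>0 < e\<close> by (simp add: power_less_imp_less_base)
    qed
    then show "\<exists>M. \<forall>m\<ge>M. \<forall>n\<ge>M. norm (F m u - F n u) < e" by blast
  qed
  then have "\<forall>u. \<exists>l. (\<lambda>j. F j u) \<longlonglongrightarrow> l" by (metis Cauchy_convergent_iff convergent_def)
  then obtain p where p: "\<And>u. (\<lambda>j. F j u) \<longlonglongrightarrow> p u" by metis
  have p0: "p u = 0" if "u \<notin> S" for u
    using p[of u] by (simp add: ell2_zero_outside[OF Fl that] LIMSEQ_const_iff)
  have inv0: "(\<lambda>i. 1 / real (Suc i)) \<longlonglongrightarrow> 0" by (rule LIMSEQ_Suc[OF lim_1_over_n])
  \<comment> \<open>On finite sets of coordinates the estimate \<open>dist\<close> passes to the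
    limit in its second index; this upgrades coordinatewise convergence to convergence in
    norm.\<close>
  have Fp: "(\<lambda>u. F j u - p u) \<in> ell2 S" "(l2_norm (\<lambda>u. F j u - p u))\<^sup>2 \<le> 2 * (1 / real (Suc j))"
    for j
  proof -
    have fin: "(\<Sum>u\<in>A. (cmod (F j u - p u))\<^sup>2) \<le> 2 * (1 / real (Suc j))" if "finite A" for A
    proof (rule LIMSEQ_le)
      show "(\<lambda>i. \<Sum>u\<in>A. (cmod (F j u - F i u))\<^sup>2) \<longlonglongrightarrow> (\<Sum>u\<in>A. (cmod (F j u - p u))\<^sup>2)"
        by (intro tendsto_intros p)
      show "(\<lambda>i. 2 * (1 / real (Suc j)) + 2 * (1 / real (Suc i))) \<longlonglongrightarrow> 2 * (1 / real (Suc j))"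
        using tendsto_add[OF tendsto_const tendsto_mult[OF tendsto_const inv0],
            of "2 * (1 / real (Suc j))" 2] by simp
      have "(\<Sum>u\<in>A. (cmod (F j u - F i u))\<^sup>2) \<le> 2 * (1 / real (Suc j)) + 2 * (1 / real (Suc i))" for i
        using finite_sum_le_l2_norm[OF ell2_diff[OF Fl[of j] Fl[of i]] that] dist[of j i] by simp
      then show "\<exists>N. \<forall>i\<ge>N. (\<Sum>u\<in>A. (cmod (F j u - F i u))\<^sup>2)
          \<le> 2 * (1 / real (Suc j)) + 2 * (1 / real (Suc i))" by blast
    qed
    show "(\<lambda>u. F j u - p u) \<in> ell2 S" "(l2_norm (\<lambda>u. F j u - p u))\<^sup>2 \<le> 2 * (1 / real (Suc j))"
      by (rule l2_norm_le_finite_sums[where S = S, OF _ fin]; simp add: p0 ell2_zero_outside[OF Fl])+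
  qed
  have pl: "p \<in> ell2 S" using ell2_diff[OF Fl[of 0] Fp(1)[of 0]] by simp
  have "(\<lambda>j. (l2_norm (\<lambda>u. F j u - p u))\<^sup>2) \<longlonglongrightarrow> 0"
  proof (rule tendsto_sandwich[OF _ _ tendsto_const])
    show "(\<lambda>j. 2 * (1 / real (Suc j))) \<longlonglongrightarrow> 0"
      using tendsto_mult[OF tendsto_const inv0, of 2] by simp
  qed (use Fp in auto)
  from tendsto_real_sqrt[OF this] have "(\<lambda>j. l2_norm (\<lambda>u. F j u - p u)) \<longlonglongrightarrow> 0" by simp
  then have pM: "p \<in> M" by (rule closed_subspace_limit[OF M pl FM])
  \<comment> \<open>Lower semicontinuity of the distance, again through finite sets of
    coordinates.\<close>
  have "(\<Sum>u\<in>A. (cmod (f u - p u))\<^sup>2) \<le> d" if "finite A" for A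
  proof (rule LIMSEQ_le)
    show "(\<lambda>i. \<Sum>u\<in>A. (cmod (f u - F i u))\<^sup>2) \<longlonglongrightarrow> (\<Sum>u\<in>A. (cmod (f u - p u))\<^sup>2)"
      by (intro tendsto_intros p)
    show "(\<lambda>i. d + 1 / real (Suc i)) \<longlonglongrightarrow> d"
      using tendsto_add[OF tendsto_const inv0, of d] by simp
    have "(\<Sum>u\<in>A. (cmod (f u - F i u))\<^sup>2) \<le> d + 1 / real (Suc i)" for i
      using finite_sum_le_l2_norm[OF ell2_diff[OF f Fl[of i]] that] NF[of i] unfolding N_def by simp
    then show "\<exists>N. \<forall>i\<ge>N. (\<Sum>u\<in>A. (cmod (f u - F i u))\<^sup>2) \<le> d + 1 / real (Suc i)" by blast
  qed
  then have Np: "N p \<le> d"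
    unfolding N_def using f p0
    by (intro l2_norm_le_finite_sums(2)[of S]) (auto simp: ell2_zero_outside)
  have "l2_inner (\<lambda>u. f u - p u) g = 0" if g: "g \<in> M" for g
  proof (rule ccontr)
    let ?a = "l2_inner (\<lambda>u. f u - p u) g"
    assume a: "?a \<noteq> 0"
    \<comment> \<open>Moving \<open>p\<close> by \<open>t * ?a * g\<close> changes the squared
      distance by \<open>(cmod ?a)\<^sup>2 * (t\<^sup>2 * (l2_norm g)\<^sup>2 - 2 * t)\<close>,
      which is negative for this \<open>t\<close>. The summand 1 keeps the denominator
      positive.\<close>
    define t where "t = 1 / ((l2_norm g)\<^sup>2 + 1)"
    have "0 < (l2_norm g)\<^sup>2 + 1" by (simp add: add_nonneg_pos)
    then have t: "0 < t" "t * (l2_norm g)\<^sup>2 < 1" unfolding t_def by simp_all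
    have "(\<lambda>u. p u + of_real t * ?a * g u) \<in> M"
      by (intro closed_subspaceD(3,4)[OF M] pM g)
    then have "d \<le> N (\<lambda>u. p u + of_real t * ?a * g u)" by (rule d_le)
    also have "N (\<lambda>u. p u + of_real t * ?a * g u)
        = (l2_norm (\<lambda>u. (f u - p u) - (of_real t * ?a) * g u))\<^sup>2"
      unfolding N_def by (simp add: algebra_simps)
    also have "\<dots> = N p - 2 * Re (cnj (of_real t * ?a) * ?a)
        + (cmod (of_real t * ?a))\<^sup>2 * (l2_norm g)\<^sup>2"
      unfolding N_def
      by (rule l2_norm_diff_square[OF ell2_diff[OF f pl] closed_subspaceD(1)[OF M g]])
    also have "Re (cnj (of_real t * ?a) * ?a) = t * (cmod ?a)\<^sup>2"
      by (simp add: cmod_power2) (simp add: power2_eq_square algebra_simps)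
    also have "(cmod (of_real t * ?a))\<^sup>2 = t * t * (cmod ?a)\<^sup>2"
      by (simp add: norm_mult power_mult_distrib power2_eq_square)
    finally have "t * (cmod ?a)\<^sup>2 * 2 \<le> t * (cmod ?a)\<^sup>2 * (t * (l2_norm g)\<^sup>2)"
      using Np by (simp add: algebra_simps)
    moreover have "0 < t * (cmod ?a)\<^sup>2" using t a by simp
    ultimately have "2 \<le> t * (l2_norm g)\<^sup>2" by (subst (asm) mult_le_cancel_left_pos)
    then show False using t by simp
  qed
  then show ?thesis using that pM by blast
qed

text \<open>Two candidates differ by a vector of \<open>M\<close> that is orthogonal to
  \<open>M\<close>, hence to itself. Values of the definite description \<open>orth_proj\<close> are
  identified by this criterion.\<close>

lemma orth_proj_eqI:
  assumes M: "closed_subspace S M" and f: "f \<in> ell2 S"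
    and p: "p \<in> M" "\<And>g. g \<in> M \<Longrightarrow> l2_inner (\<lambda>u. f u - p u) g = 0"
  shows "orth_proj M f = p"
  unfolding orth_proj_def
proof (rule the_equality)
  fix q assume q: "q \<in> M \<and> (\<forall>g\<in>M. l2_inner (\<lambda>u. f u - q u) g = 0)"
  let ?h = "\<lambda>u. p u - q u"
  note l = closed_subspaceD(1)[OF M]
  have h: "?h \<in> M" by (rule closed_subspaceD(5)[OF M]) (use p q in auto)
  have "l2_inner (\<lambda>u. (f u - q u) - (f u - p u)) ?h
      = l2_inner (\<lambda>u. f u - q u) ?h - l2_inner (\<lambda>u. f u - p u) ?h"
    using p q by (intro l2_inner_diff[of _ S] ell2_diff f l h) auto
  then have "l2_inner ?h ?h = 0" using p q h by simp
  then have "l2_norm ?h = 0" using l2_inner_self[OF l[OF h]] by simp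
  from l2_norm_zero_imp[OF l[OF h] this] show "q = p" by (auto simp: fun_eq_iff)
qed (use p in blast)

lemma
  assumes M: "closed_subspace S M" and f: "f \<in> ell2 S"
  shows orth_proj_in: "orth_proj M f \<in> M"
    and orth_proj_orthogonal: "g \<in> M \<Longrightarrow> l2_inner (\<lambda>u. f u - orth_proj M f u) g = 0"
proof -
  obtain p where p: "p \<in> M" "\<And>g. g \<in> M \<Longrightarrow> l2_inner (\<lambda>u. f u - p u) g = 0"
    by (rule projection_theorem[OF M f], rule that)
  then have "orth_proj M f = p" by (rule orth_proj_eqI[OF M f])
  then show "orth_proj M f \<in> M" "g \<in> M \<Longrightarrow> l2_inner (\<lambda>u. f u - orth_proj M f u) g = 0"
    using p by simp_all
qed

lemma orth_proj_ell2: "closed_subspace S M \<Longrightarrow> f \<in> ell2 S \<Longrightarrow> orth_proj M f \<in> ell2 S"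
  by (rule closed_subspaceD(1)[OF _ orth_proj_in])

lemma orth_proj_self:
  assumes M: "closed_subspace S M" and f: "f \<in> M"
  shows "orth_proj M f = f"
  by (rule orth_proj_eqI[OF M closed_subspaceD(1)[OF M f] f]) (simp add: l2_inner_def)

lemma orth_proj_add:
  assumes M: "closed_subspace S M" and f: "f \<in> ell2 S" and g: "g \<in> ell2 S"
  shows "orth_proj M (\<lambda>u. f u + g u) = (\<lambda>u. orth_proj M f u + orth_proj M g u)"
proof (rule orth_proj_eqI[OF M ell2_add[OF f g]])
  fix h assume h: "h \<in> M"
  have "l2_inner (\<lambda>u. (f u - orth_proj M f u) + (g u - orth_proj M g u)) h = 0"
    using l2_inner_add[OF ell2_diff[OF f orth_proj_ell2[OF M f]]
        ell2_diff[OF g orth_proj_ell2[OF M g]] closed_subspaceD(1)[OF M h]]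
      orth_proj_orthogonal[OF M f h] orth_proj_orthogonal[OF M g h] by simp
  then show "l2_inner (\<lambda>u. f u + g u - (orth_proj M f u + orth_proj M g u)) h = 0"
    by (simp add: algebra_simps)
qed (intro closed_subspaceD(3)[OF M] orth_proj_in[OF M] f g)

lemma orth_proj_scale:
  assumes M: "closed_subspace S M" and f: "f \<in> ell2 S"
  shows "orth_proj M (\<lambda>u. c * f u) = (\<lambda>u. c * orth_proj M f u)"
proof (rule orth_proj_eqI[OF M ell2_scale[OF f]])
  fix h assume h: "h \<in> M"
  show "l2_inner (\<lambda>u. c * f u - c * orth_proj M f u) h = 0"
    using l2_inner_scale[of c "\<lambda>u. f u - orth_proj M f u" h] orth_proj_orthogonal[OF M f h]
    by (simp add: algebra_simps)
qed (intro closed_subspaceD(4)[OF M] orth_proj_in[OF M] f)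

text \<open>Both sides equal the inner product of the two projections, because the residuals are
  orthogonal to \<open>M\<close>.\<close>

lemma l2_inner_orth_proj:
  assumes M: "closed_subspace S M" and f: "f \<in> ell2 S" and g: "g \<in> ell2 S"
  shows "l2_inner (orth_proj M f) g = l2_inner f (orth_proj M g)"
proof -
  note P = orth_proj_ell2[OF M]
  have "l2_inner f (orth_proj M g) = l2_inner (orth_proj M f) (orth_proj M g)"
    using orth_proj_orthogonal[OF M f orth_proj_in[OF M g]] l2_inner_diff[OF f P[OF f] P[OF g]]
    by simp
  also have "\<dots> = cnj (l2_inner (orth_proj M g) (orth_proj M f))" by (rule l2_inner_commute)
  also have "\<dots> = cnj (l2_inner g (orth_proj M f))"
    using orth_proj_orthogonal[OF M g orth_proj_in[OF M f]] l2_inner_diff[OF g P[OF g] P[OF f]]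
    by simp
  also have "\<dots> = l2_inner (orth_proj M f) g" by (rule l2_inner_commute[symmetric])
  finally show ?thesis ..
qed

section \<open>The weak operator topology and the commutant of a projection\<close>

lemma topspace_wot: "topspace (wot S) = bounded_ops S"
proof -
  have "bounded_ops S \<in> {{A \<in> bounded_ops S. l2_inner (A f) g \<in> U} | f g U.
      f \<in> ell2 S \<and> g \<in> ell2 S \<and> open U}"
    by (intro CollectI exI[of _ "\<lambda>_. 0"] exI[of _ UNIV]) auto
  then show ?thesis unfolding wot_def topology_generated_by_topspace by blast
qed

lemma continuous_map_wot:
  assumes "f \<in> ell2 S" "g \<in> ell2 S"
  shows "continuous_map (wot S) euclidean (\<lambda>A. l2_inner (A f) g)"
  unfolding continuous_map_def topspace_wot
proof (intro conjI allI impI)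
  fix U :: "complex set" assume "openin euclidean U"
  then show "openin (wot S) {A \<in> bounded_ops S. l2_inner (A f) g \<in> U}"
    unfolding wot_def using assms by (intro topology_generated_by_Basis) auto
qed auto

lemma ell2_eqI:
  assumes "f \<in> ell2 S" "g \<in> ell2 S" "\<And>h. h \<in> ell2 S \<Longrightarrow> l2_inner f h = l2_inner g h"
  shows "f = g"
proof
  fix u
  show "f u = g u"
    using assms(3)[OF ket_in_ell2, of u] assms(1,2)
    by (cases "u \<in> S") (auto simp: l2_inner_ket ell2_zero_outside)
qed

text \<open>For a closed subspace this set is a unital algebra closed in the weak operator topology.
  It therefore contains the generated algebra as soon as it contains the generators, and reduction
  can be checked on the shifts alone.\<close>

definition proj_commutant :: "'g set \<Rightarrow> ('g \<Rightarrow> complex) set \<Rightarrow> 'g operator set" where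
  "proj_commutant S M =
    {A \<in> bounded_ops S. \<forall>f\<in>ell2 S. orth_proj M (A f) = A (orth_proj M f)}"

lemma bounded_opsD:
  assumes "A \<in> bounded_ops S"
  shows "f \<notin> ell2 S \<Longrightarrow> A f = (\<lambda>_. 0)" "f \<in> ell2 S \<Longrightarrow> A f \<in> ell2 S"
    "f \<in> ell2 S \<Longrightarrow> g \<in> ell2 S \<Longrightarrow> A (\<lambda>u. f u + g u) = (\<lambda>u. A f u + A g u)"
    "f \<in> ell2 S \<Longrightarrow> A (\<lambda>u. c * f u) = (\<lambda>u. c * A f u)"
  using assms by (auto simp: bounded_ops_def)

lemma bounded_opsE:
  assumes "A \<in> bounded_ops S"
  obtains C where "0 \<le> C" "\<And>f. f \<in> ell2 S \<Longrightarrow> l2_norm (A f) \<le> C * l2_norm f"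
proof -
  obtain C where C: "\<And>f. f \<in> ell2 S \<Longrightarrow> l2_norm (A f) \<le> C * l2_norm f"
    using assms unfolding bounded_ops_def by blast
  have "l2_norm (A f) \<le> max C 0 * l2_norm f" if "f \<in> ell2 S" for f
    by (rule order_trans[OF C[OF that]]) (simp add: mult_right_mono)
  then show ?thesis using that[of "max C 0"] by simp
qed

text \<open>Moving the self-adjoint projection to the second argument turns commutation into
  equality of two functionals of \<open>A\<close> that are continuous by definition of the topology.
  The commutant is thus an intersection of closed equalizers.\<close>

lemma closedin_proj_commutant:
  assumes M: "closed_subspace S M"
  shows "closedin (wot S) (proj_commutant S M)"
proof -
  note P = orth_proj_ell2[OF M]
  have "proj_commutant S M = (\<Inter>(f, g) \<in> ell2 S \<times> ell2 S.
      {A \<in> topspace (wot S). l2_inner (A f) (orth_proj M g) = l2_inner (A (orth_proj M f)) g})"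
    (is "_ = ?R")
  proof (intro equalityI subsetI)
    fix A assume "A \<in> proj_commutant S M"
    then show "A \<in> ?R"
      by (auto simp: proj_commutant_def topspace_wot bounded_opsD(2) simp flip: l2_inner_orth_proj[OF M])
  next
    fix A assume R: "A \<in> ?R"
    \<comment> \<open>Membership in an intersection says something about \<open>A\<close> only
      because the index set is nonempty; the zero vector is the index used.\<close>
    then have "\<forall>f\<in>ell2 S. \<forall>g\<in>ell2 S. A \<in> bounded_ops S" by (auto simp: topspace_wot)
    then have A: "A \<in> bounded_ops S" by (meson ell2_zero)
    have "orth_proj M (A f) = A (orth_proj M f)" if f: "f \<in> ell2 S" for f
    proof (rule ell2_eqI)
      show "orth_proj M (A f) \<in> ell2 S" "A (orth_proj M f) \<in> ell2 S"
        using f by (auto intro: P bounded_opsD(2)[OF A])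
      show "l2_inner (orth_proj M (A f)) h = l2_inner (A (orth_proj M f)) h" if "h \<in> ell2 S" for h
        using R f that l2_inner_orth_proj[OF M bounded_opsD(2)[OF A f] that] by auto
    qed
    then show "A \<in> proj_commutant S M" using A by (simp add: proj_commutant_def)
  qed
  also have "closedin (wot S) \<dots>"
  proof (intro closedin_INT)
    fix z assume "z \<in> ell2 S \<times> ell2 S"
    then obtain f g where z: "z = (f, g)" "f \<in> ell2 S" "g \<in> ell2 S" by blast
    show "closedin (wot S) (case z of (f, g) \<Rightarrow> {A \<in> topspace (wot S).
        l2_inner (A f) (orth_proj M g) = l2_inner (A (orth_proj M f)) g})"
      unfolding z(1) prod.case
      using z by (intro closedin_continuous_maps_eq[where Y = euclidean] continuous_map_wot P)
        auto
  qed (use ell2_zero in blast)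
  finally show ?thesis .
qed

lemma id_op_bounded: "id_op S \<in> bounded_ops S"
  by (auto simp: bounded_ops_def id_op_def ell2_add ell2_scale intro!: exI[of _ 1])

lemma l2_norm_scale: "l2_norm (\<lambda>u. c * f u) = cmod c * l2_norm f"
  unfolding l2_norm_def
  by (simp add: norm_mult power_mult_distrib infsum_cmult_right' real_sqrt_mult)

lemma l2_norm_add_square_le:
  assumes "f \<in> ell2 S" "g \<in> ell2 S"
  shows "(l2_norm (\<lambda>u. f u + g u))\<^sup>2 \<le> 2 * (l2_norm f)\<^sup>2 + 2 * (l2_norm g)\<^sup>2"
proof -
  have "(\<Sum>\<^sub>\<infinity>u. (cmod (f u + g u))\<^sup>2) \<le> (\<Sum>\<^sub>\<infinity>u. 2 * (cmod (f u))\<^sup>2 + 2 * (cmod (g u))\<^sup>2)"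
    using assms by (intro infsum_mono summable_on_add summable_on_cmult_right ell2_summable
        cmod_add_square_le ell2_add)
  also have "\<dots> = (\<Sum>\<^sub>\<infinity>u. 2 * (cmod (f u))\<^sup>2) + (\<Sum>\<^sub>\<infinity>u. 2 * (cmod (g u))\<^sup>2)"
    using assms by (intro infsum_add summable_on_cmult_right ell2_summable)
  finally show ?thesis unfolding l2_norm_square by (simp add: infsum_cmult_right')
qed

lemma unital_subalgebra_proj_commutant:
  assumes M: "closed_subspace S M"
  shows "unital_subalgebra S (proj_commutant S M)"
  unfolding unital_subalgebra_def
proof (intro conjI ballI allI)
  note P = orth_proj_ell2[OF M]
  show "proj_commutant S M \<subseteq> bounded_ops S" by (auto simp: proj_commutant_def)
  show "id_op S \<in> proj_commutant S M"
    using P id_op_bounded by (auto simp: proj_commutant_def id_op_def)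
  fix A assume A': "A \<in> proj_commutant S M"
  then have A: "A \<in> bounded_ops S"
    and PA: "\<And>f. f \<in> ell2 S \<Longrightarrow> orth_proj M (A f) = A (orth_proj M f)"
    by (auto simp: proj_commutant_def)
  note Al = bounded_opsD(2)[OF A]
  obtain C where C: "0 \<le> C" "\<And>f. f \<in> ell2 S \<Longrightarrow> l2_norm (A f) \<le> C * l2_norm f"
    by (rule bounded_opsE[OF A], rule that)
  show "(\<lambda>f u. c * A f u) \<in> proj_commutant S M" for c
  proof -
    have "(\<lambda>f u. c * A f u) \<in> bounded_ops S"
      unfolding bounded_ops_def
    proof (intro CollectI conjI exI[of _ "cmod c * C"] ballI allI impI)
      fix f assume f: "f \<in> ell2 S"
      show "l2_norm (\<lambda>u. c * A f u) \<le> cmod c * C * l2_norm f"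
        unfolding l2_norm_scale using C(2)[OF f] by (simp add: mult.assoc mult_left_mono)
    qed (auto simp: bounded_opsD[OF A] ell2_scale fun_eq_iff algebra_simps)
    then show ?thesis
      using PA Al by (auto simp: proj_commutant_def orth_proj_scale[OF M])
  qed
  fix B assume B': "B \<in> proj_commutant S M"
  then have B: "B \<in> bounded_ops S"
    and PB: "\<And>f. f \<in> ell2 S \<Longrightarrow> orth_proj M (B f) = B (orth_proj M f)"
    by (auto simp: proj_commutant_def)
  note Bl = bounded_opsD(2)[OF B]
  obtain D where D: "0 \<le> D" "\<And>f. f \<in> ell2 S \<Longrightarrow> l2_norm (B f) \<le> D * l2_norm f"
    by (rule bounded_opsE[OF B], rule that)
  show "(\<lambda>f u. A f u + B f u) \<in> proj_commutant S M"
  proof -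
    have "(\<lambda>f u. A f u + B f u) \<in> bounded_ops S"
      unfolding bounded_ops_def
    \<comment> \<open>This constant is not sharp; it absorbs the factor 2 in the squared estimate
      that replaces the triangle inequality.\<close>
    proof (intro CollectI conjI exI[of _ "2 * (C + D)"] ballI allI impI)
      fix f assume f: "f \<in> ell2 S"
      have "(l2_norm (\<lambda>u. A f u + B f u))\<^sup>2 \<le> 2 * (l2_norm (A f))\<^sup>2 + 2 * (l2_norm (B f))\<^sup>2"
        by (rule l2_norm_add_square_le[OF Al[OF f] Bl[OF f]])
      also have "\<dots> \<le> 2 * (C * l2_norm f)\<^sup>2 + 2 * (D * l2_norm f)\<^sup>2"
        using C(2)[OF f] D(2)[OF f] by (intro add_mono mult_left_mono power_mono) auto
      also have "\<dots> \<le> (2 * (C + D) * l2_norm f)\<^sup>2"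
      proof -
        have "2 * C\<^sup>2 + 2 * D\<^sup>2 \<le> (2 * (C + D))\<^sup>2"
          using C(1) D(1) by (simp add: power2_eq_square algebra_simps)
        then have "(2 * C\<^sup>2 + 2 * D\<^sup>2) * (l2_norm f)\<^sup>2 \<le> (2 * (C + D))\<^sup>2 * (l2_norm f)\<^sup>2"
          by (rule mult_right_mono) simp
        then show ?thesis unfolding power_mult_distrib distrib_right by (simp only: mult.assoc)
      qed
      finally show "l2_norm (\<lambda>u. A f u + B f u) \<le> 2 * (C + D) * l2_norm f"
        by (rule power2_le_imp_le) (use C D in auto)
    qed (auto simp: bounded_opsD[OF A] bounded_opsD[OF B] ell2_add fun_eq_iff algebra_simps)
    then show ?thesis
      using PA PB Al Bl by (auto simp: proj_commutant_def orth_proj_add[OF M])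
  qed
  show "A \<circ> B \<in> proj_commutant S M"
  proof -
    \<comment> \<open>Off \<open>ell2 S\<close> the operator \<open>B\<close> returns the zero
      vector, and the composition stays normalised because \<open>A\<close> sends it to
      zero.\<close>
    have "A (\<lambda>_. 0) = (\<lambda>_. 0)" using bounded_opsD(4)[OF A, of "\<lambda>_. 0" 0] by simp
    then have "A \<circ> B \<in> bounded_ops S"
      unfolding bounded_ops_def
    proof (intro CollectI conjI exI[of _ "C * D"] ballI allI impI)
      fix f assume f: "f \<in> ell2 S"
      have "l2_norm (A (B f)) \<le> C * l2_norm (B f)" by (rule C(2)[OF Bl[OF f]])
      also have "\<dots> \<le> C * (D * l2_norm f)" by (rule mult_left_mono[OF D(2)[OF f] C(1)])
      finally show "l2_norm ((A \<circ> B) f) \<le> C * D * l2_norm f" by (simp add: mult.assoc)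
    qed (auto simp: bounded_opsD[OF A] bounded_opsD[OF B])
    then show ?thesis using PA PB P Bl by (auto simp: proj_commutant_def)
  qed
qed

lemma reduces_wot_algebraI:
  assumes M: "closed_subspace S M" and T: "\<T> \<subseteq> proj_commutant S M"
  shows "reduces S M (wot_algebra S \<T>)"
proof -
  have "wot_algebra S \<T> \<subseteq> proj_commutant S M"
    unfolding wot_algebra_def
    using T unital_subalgebra_proj_commutant[OF M] closedin_proj_commutant[OF M]
    by (intro hull_minimal) auto
  then show ?thesis using M by (auto simp: reduces_def proj_commutant_def)
qed

lemma subset_wot_algebra: "\<T> \<subseteq> wot_algebra S \<T>"
  unfolding wot_algebra_def by (rule hull_subset)

section \<open>Cauchy-Schwarz, orthogonal complements and approximation by finite supports\<close>

lemma l2_norm_ket [simp]: "l2_norm (ket u) = 1"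
proof -
  have "of_real ((l2_norm (ket u))\<^sup>2) = (1 :: complex)"
    using l2_inner_self[OF ket_in_ell2[of u UNIV]] l2_inner_ket[of "ket u" u]
    by (simp add: ket_def)
  then have "(l2_norm (ket u))\<^sup>2 = 1" using of_real_eq_1_iff by blast
  then show ?thesis using l2_norm_nonneg[of "ket u"] by (simp add: power2_eq_1_iff)
qed

lemma l2_Cauchy_Schwarz:
  assumes f: "f \<in> ell2 S" and g: "g \<in> ell2 S"
  shows "cmod (l2_inner f g) \<le> l2_norm f * l2_norm g"
proof (cases "l2_norm g = 0")
  case True
  then have "g = (\<lambda>_. 0)" by (rule l2_norm_zero_imp[OF g])
  then show ?thesis by (simp add: l2_inner_def)
next
  case False
  let ?a = "l2_inner f g"
  \<comment> \<open>The multiple \<open>c * g\<close> is the projection of \<open>f\<close> onto the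
    line through \<open>g\<close>.\<close>
  define c where "c = ?a / of_real ((l2_norm g)\<^sup>2)"
  have "0 \<le> (l2_norm (\<lambda>u. f u - c * g u))\<^sup>2" by simp
  also have "\<dots> = (l2_norm f)\<^sup>2 - 2 * Re (cnj c * ?a) + (cmod c)\<^sup>2 * (l2_norm g)\<^sup>2"
    by (rule l2_norm_diff_square[OF f g])
  also have "cnj c * ?a = of_real ((cmod ?a)\<^sup>2 / (l2_norm g)\<^sup>2)"
    unfolding c_def of_real_divide complex_norm_square by simp
  also have "(cmod c)\<^sup>2 * (l2_norm g)\<^sup>2 = (cmod ?a)\<^sup>2 / (l2_norm g)\<^sup>2"
    using False unfolding c_def
    by (simp add: norm_divide norm_power power_divide) (simp add: power2_eq_square power4_eq_xxxx)
  finally have "(cmod ?a)\<^sup>2 / (l2_norm g)\<^sup>2 \<le> (l2_norm f)\<^sup>2" by simp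
  then have "(cmod ?a)\<^sup>2 \<le> (l2_norm f * l2_norm g)\<^sup>2"
    using False by (simp add: divide_le_eq power_mult_distrib)
  then show ?thesis by (rule power2_le_imp_le) simp
qed

text \<open>Only closedness needs an argument: by Cauchy-Schwarz the inner product with a fixed
  vector is continuous in norm.\<close>

lemma closed_subspace_orthogonal:
  assumes G: "G \<subseteq> ell2 S"
  shows "closed_subspace S {f \<in> ell2 S. \<forall>g\<in>G. l2_inner f g = 0}"
  unfolding closed_subspace_def
proof (intro conjI allI ballI impI)
  let ?M = "{f \<in> ell2 S. \<forall>g\<in>G. l2_inner f g = 0}"
  show "(\<lambda>_. 0) \<in> ?M" by (simp add: l2_inner_def)
  show "(\<lambda>u. f u + g u) \<in> ?M" if f: "f \<in> ?M" and g: "g \<in> ?M" for f g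
  proof -
    have "l2_inner (\<lambda>u. f u + g u) h = 0" if "h \<in> G" for h
      using l2_inner_add[of f S g h] f g G that by auto
    then show ?thesis using f g by (simp add: ell2_add)
  qed
  show "(\<lambda>u. c * f u) \<in> ?M" if "f \<in> ?M" for f c
    using that by (auto simp: ell2_scale l2_inner_scale)
  fix F f
  assume f: "f \<in> ell2 S"
    and F: "(\<forall>j::nat. F j \<in> ?M) \<and> (\<lambda>j. l2_norm (\<lambda>u. F j u - f u)) \<longlonglongrightarrow> 0"
  have "l2_inner f g = 0" if g: "g \<in> G" for g
  proof -
    have gl: "g \<in> ell2 S" using g G by blast
    have Fl: "F j \<in> ell2 S" for j using F by blast
    have bd: "cmod (l2_inner f g) \<le> l2_norm (\<lambda>u. F j u - f u) * l2_norm g" for j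
    proof -
      have "l2_inner (\<lambda>u. F j u - f u) g = - l2_inner f g"
        using l2_inner_diff[OF Fl[of j] f gl] F g by simp
      then show ?thesis using l2_Cauchy_Schwarz[OF ell2_diff[OF Fl[of j] f] gl] by simp
    qed
    have "(\<lambda>j. l2_norm (\<lambda>u. F j u - f u) * l2_norm g) \<longlonglongrightarrow> 0 * l2_norm g"
      using F by (intro tendsto_mult tendsto_const) auto
    then have "cmod (l2_inner f g) \<le> 0 * l2_norm g"
      by (rule LIMSEQ_le_const) (use bd in blast)
    then show ?thesis by simp
  qed
  then show "f \<in> ?M" using f by blast
qed auto

lemma ell2_truncation:
  assumes f: "f \<in> ell2 S" and "0 < e"
  obtains F where "finite F" "(l2_norm (\<lambda>u. if u \<in> F then 0 else f u))\<^sup>2 \<le> e"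
proof -
  obtain F where F: "finite F"
    and d: "dist (\<Sum>u\<in>F. (cmod (f u))\<^sup>2) (\<Sum>\<^sub>\<infinity>u. (cmod (f u))\<^sup>2) \<le> e"
    using infsum_finite_approximation[OF ell2_summable[OF f] \<open>0 < e\<close>] by blast
  let ?r = "\<lambda>u. if u \<in> F then 0 else f u"
  have 1: "(\<Sum>\<^sub>\<infinity>u. if u \<in> F then (cmod (f u))\<^sup>2 else 0) = (\<Sum>u\<in>F. (cmod (f u))\<^sup>2)"
    using F by (intro infsumI has_sum_finite_neutralI[of F]) auto
  have s1: "(\<lambda>u. if u \<in> F then (cmod (f u))\<^sup>2 else 0) summable_on UNIV"
    using ell2_summable[OF f] by (rule summable_on_comparison_test) auto
  have s2: "(\<lambda>u. (cmod (?r u))\<^sup>2) summable_on UNIV"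
    using ell2_summable[OF f] by (rule summable_on_comparison_test) auto
  have "(\<Sum>\<^sub>\<infinity>u. (cmod (f u))\<^sup>2)
      = (\<Sum>\<^sub>\<infinity>u. (if u \<in> F then (cmod (f u))\<^sup>2 else 0) + (cmod (?r u))\<^sup>2)"
    by (rule infsum_cong) auto
  also have "\<dots> = (\<Sum>u\<in>F. (cmod (f u))\<^sup>2) + (l2_norm ?r)\<^sup>2"
    unfolding infsum_add[OF s1 s2] 1 l2_norm_square ..
  finally show ?thesis using d F that[of F] by (simp add: dist_real_def)
qed

text \<open>The coordinate form of the fact that a bounded operator is determined by the basis
  vectors. Finite truncations of \<open>f\<close> are handled by linearity, and the remainder is
  made small by boundedness.\<close>

lemma bounded_op_apply_eq_0:
  assumes A: "A \<in> bounded_ops S" and f: "f \<in> ell2 S"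
    and 0: "\<And>v. v \<in> S \<Longrightarrow> f v \<noteq> 0 \<Longrightarrow> A (ket v) x = 0"
  shows "A f x = 0"
proof -
  obtain C where C: "0 \<le> C" "\<And>f. f \<in> ell2 S \<Longrightarrow> l2_norm (A f) \<le> C * l2_norm f"
    by (rule bounded_opsE[OF A], rule that)
  have fin: "(\<lambda>u. if u \<in> F then f u else 0) \<in> ell2 S \<and> A (\<lambda>u. if u \<in> F then f u else 0) x = 0"
    if "finite F" for F
    using that
  proof (induction F)
    case empty
    show ?case using bounded_opsD(4)[OF A ell2_zero, of 0] by simp
  next
    case (insert v F)
    let ?g = "\<lambda>u. if u \<in> F then f u else 0"
    show ?case
    proof (cases "f v = 0")
      case True
      then have "(\<lambda>u. if u \<in> insert v F then f u else 0) = ?g" by auto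
      then show ?thesis using insert.IH by simp
    next
      case False
      then have v: "v \<in> S" using ell2_zero_outside[OF f] by blast
      have kv: "(\<lambda>u. f v * ket v u) \<in> ell2 S" by (intro ell2_scale ket_in_ell2 v)
      have "(\<lambda>u. if u \<in> insert v F then f u else 0) = (\<lambda>u. ?g u + f v * ket v u)"
        using insert.hyps by (auto simp: ket_def)
      then show ?thesis
        using insert.IH kv bounded_opsD(3)[OF A, of ?g] bounded_opsD(4)[OF A ket_in_ell2[OF v], of "f v"]
          0[OF v False] by (simp add: ell2_add)
    qed
  qed
  have "(cmod (A f x))\<^sup>2 \<le> e" if "0 < e" for e
  proof -
    \<comment> \<open>The added 1 covers the case \<open>C = 0\<close>.\<close>
    define e' where "e' = e / (C\<^sup>2 + 1)"
    have "0 < C\<^sup>2 + 1" by (simp add: add_nonneg_pos)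
    then have e': "0 < e'" "C\<^sup>2 * e' \<le> e"
      using \<open>0 < e\<close> by (simp_all add: e'_def divide_le_eq)
    obtain F where F: "finite F" "(l2_norm (\<lambda>u. if u \<in> F then 0 else f u))\<^sup>2 \<le> e'"
      by (rule ell2_truncation[OF f e'(1)], rule that)
    let ?g = "\<lambda>u. if u \<in> F then f u else 0" and ?r = "\<lambda>u. if u \<in> F then 0 else f u"
    have g: "?g \<in> ell2 S" "A ?g x = 0" using fin[OF F(1)] by auto
    have req: "?r = (\<lambda>u. f u - ?g u)" by auto
    have r: "?r \<in> ell2 S" unfolding req by (rule ell2_diff[OF f g(1)])
    have "(\<lambda>u. ?g u + ?r u) = f" by auto
    with bounded_opsD(3)[OF A g(1) r] have "A f x = A ?g x + A ?r x" by simp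
    then have "cmod (A f x) = cmod (A ?r x)" using g by simp
    also have "\<dots> \<le> C * l2_norm ?r"
      using cmod_le_l2_norm[OF bounded_opsD(2)[OF A r]] C(2)[OF r] by (rule order_trans)
    finally have "(cmod (A f x))\<^sup>2 \<le> (C * l2_norm ?r)\<^sup>2" by (rule power_mono) simp
    also have "\<dots> \<le> C\<^sup>2 * e'" unfolding power_mult_distrib using F(2) by (intro mult_left_mono) auto
    finally show ?thesis using e'(2) by simp
  qed
  then have "(cmod (A f x))\<^sup>2 \<le> 0 + e" if "0 < e" for e using that by simp
  then have "(cmod (A f x))\<^sup>2 \<le> 0" by (rule field_le_epsilon)
  then show ?thesis by simp
qed

section \<open>Weighted shifts\<close>

text \<open>The operator theory is carried out for abstract injective maps \<open>s i\<close> on a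
  vertex set; the free group enters only through the interpretation of this locale.\<close>

locale weighted_tree_shift =
  fixes S :: "'g set" and I :: "'i set" and s :: "'i \<Rightarrow> 'g \<Rightarrow> 'g"
    and \<Lambda> :: "'g \<Rightarrow> real" and T :: "'i \<Rightarrow> 'g operator"
  assumes step_in: "i \<in> I \<Longrightarrow> u \<in> S \<Longrightarrow> s i u \<in> S"
    and step_inj: "i \<in> I \<Longrightarrow> u \<in> S \<Longrightarrow> v \<in> S \<Longrightarrow> s i u = s i v \<Longrightarrow> u = v"
    and weight_pos: "u \<in> S \<Longrightarrow> 0 < \<Lambda> u"
    and T_bounded: "i \<in> I \<Longrightarrow> T i \<in> bounded_ops S"
    and T_ket: "i \<in> I \<Longrightarrow> u \<in> S \<Longrightarrow> T i (ket u) = (\<lambda>x. of_real (\<Lambda> (s i u)) * ket (s i u) x)"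
begin

text \<open>After the \<open>u\<close> component is subtracted, the remaining basis vectors are sent
  to multiples of \<open>ket (s i v)\<close> with \<open>v \<noteq> u\<close>, and injectivity of
  \<open>s i\<close> keeps these away from \<open>s i u\<close>.\<close>

lemma T_step:
  assumes i: "i \<in> I" and u: "u \<in> S" and f: "f \<in> ell2 S"
  shows "T i f (s i u) = of_real (\<Lambda> (s i u)) * f u"
proof -
  let ?g = "\<lambda>x. f x - f u * ket u x"
  have k: "(\<lambda>x. f u * ket u x) \<in> ell2 S" by (intro ell2_scale ket_in_ell2 u)
  have g: "?g \<in> ell2 S" by (rule ell2_diff[OF f k])
  have "T i ?g (s i u) = 0"
  proof (rule bounded_op_apply_eq_0[OF T_bounded[OF i] g])
    fix v assume "v \<in> S" "?g v \<noteq> 0"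
    then show "T i (ket v) (s i u) = 0"
      using step_inj[OF i u, of v] by (auto simp: T_ket[OF i] ket_apply)
  qed
  moreover have "T i f = (\<lambda>x. T i ?g x + f u * T i (ket u) x)"
    using bounded_opsD(3)[OF T_bounded[OF i] g k]
      bounded_opsD(4)[OF T_bounded[OF i] ket_in_ell2[OF u], of "f u"] by simp
  ultimately show ?thesis by (simp add: T_ket[OF i u] ket_apply)
qed

lemma T_outside:
  assumes "i \<in> I" "f \<in> ell2 S" "x \<notin> s i ` S"
  shows "T i f x = 0"
  by (rule bounded_op_apply_eq_0[OF T_bounded])
    (use assms in \<open>auto simp: T_ket ket_apply\<close>)

text \<open>The Hilbert space adjoint of \<open>T i\<close> in coordinates;
  \<open>l2_inner_T\<close> justifies the name.\<close>

definition adj :: "'i \<Rightarrow> 'g operator" where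
  "adj i g = (\<lambda>u. if u \<in> S then of_real (\<Lambda> (s i u)) * g (s i u) else 0)"

text \<open>Testing \<open>T i\<close> on basis vectors shows that its weights are bounded by any
  operator bound \<open>C\<close>; injectivity of \<open>s i\<close> then makes the reindexed
  squares summable.\<close>

lemma adj_ell2:
  assumes i: "i \<in> I" and g: "g \<in> ell2 S"
  shows "adj i g \<in> ell2 S"
proof -
  obtain C where C: "0 \<le> C" "\<And>f. f \<in> ell2 S \<Longrightarrow> l2_norm (T i f) \<le> C * l2_norm f"
    by (rule bounded_opsE[OF T_bounded[OF i]], rule that)
  have le: "\<Lambda> (s i u) \<le> C" if u: "u \<in> S" for u
  proof -
    note k = ket_in_ell2[OF u]
    have "cmod (T i (ket u) (s i u)) \<le> l2_norm (T i (ket u))"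
      by (rule cmod_le_l2_norm[OF bounded_opsD(2)[OF T_bounded[OF i] k]])
    also have "\<dots> \<le> C" using C(2)[OF k] by simp
    finally show ?thesis by (simp add: T_ket[OF i u] ket_apply)
  qed
  have inj: "inj_on (s i) S" using step_inj[OF i] by (auto intro: inj_onI)
  have "(\<lambda>x. (cmod (g x))\<^sup>2) summable_on (s i ` S)"
    by (rule summable_on_subset[OF ell2_summable[OF g]]) simp
  then have "(\<lambda>u. (cmod (g (s i u)))\<^sup>2) summable_on S"
    by (simp add: summable_on_reindex[OF inj] o_def)
  then have "(\<lambda>u. C\<^sup>2 * (cmod (g (s i u)))\<^sup>2) summable_on S" by (rule summable_on_cmult_right)
  then have "(\<lambda>u. (cmod (adj i g u))\<^sup>2) summable_on S"
  proof (rule summable_on_comparison_test)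
    fix u assume u: "u \<in> S"
    then have "(\<Lambda> (s i u))\<^sup>2 \<le> C\<^sup>2"
      using le[OF u] weight_pos[OF step_in[OF i u]] by (intro power_mono) auto
    then show "(cmod (adj i g u))\<^sup>2 \<le> C\<^sup>2 * (cmod (g (s i u)))\<^sup>2"
      using u by (simp add: adj_def norm_mult power_mult_distrib mult_right_mono)
  qed auto
  then show ?thesis by (auto simp: ell2_def adj_def)
qed

lemma l2_inner_T:
  assumes i: "i \<in> I" and f: "f \<in> ell2 S"
  shows "l2_inner (T i f) g = l2_inner f (adj i g)"
proof -
  have inj: "inj_on (s i) S" using step_inj[OF i] by (auto intro: inj_onI)
  have "l2_inner (T i f) g = (\<Sum>\<^sub>\<infinity>x\<in>s i ` S. T i f x * cnj (g x))"
    unfolding l2_inner_def using T_outside[OF i f] by (intro infsum_cong_neutral) auto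
  also have "\<dots> = (\<Sum>\<^sub>\<infinity>u\<in>S. T i f (s i u) * cnj (g (s i u)))"
    by (simp add: infsum_reindex[OF inj] o_def)
  also have "\<dots> = (\<Sum>\<^sub>\<infinity>u\<in>S. f u * cnj (adj i g u))"
    by (rule infsum_cong) (simp add: T_step[OF i _ f] adj_def)
  also have "\<dots> = l2_inner f (adj i g)"
    unfolding l2_inner_def using f by (intro infsum_cong_neutral) (auto simp: ell2_zero_outside)
  finally show ?thesis .
qed

end

section \<open>Matrix entries of a projection that commutes with the shifts\<close>

context weighted_tree_shift
begin

definition proj_entry :: "('g \<Rightarrow> complex) set \<Rightarrow> 'g \<Rightarrow> 'g \<Rightarrow> complex" where
  "proj_entry M u v = orth_proj M (ket v) u"

lemma proj_entry_cnj:
  assumes M: "closed_subspace S M" and u: "u \<in> S" and v: "v \<in> S"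
  shows "proj_entry M v u = cnj (proj_entry M u v)"
proof -
  have "proj_entry M v u = l2_inner (orth_proj M (ket u)) (ket v)" by (simp add: proj_entry_def l2_inner_ket)
  also have "\<dots> = l2_inner (ket u) (orth_proj M (ket v))"
    by (rule l2_inner_orth_proj[OF M ket_in_ell2[OF u] ket_in_ell2[OF v]])
  also have "\<dots> = cnj (proj_entry M u v)"
    by (subst l2_inner_commute) (simp add: proj_entry_def l2_inner_ket)
  finally show ?thesis .
qed

context
  fixes M
  assumes M: "closed_subspace S M"
    and commutes: "\<forall>i\<in>I. \<forall>f\<in>ell2 S. orth_proj M (T i f) = T i (orth_proj M f)"
begin

lemma proj_entry_T:
  assumes i: "i \<in> I" and v: "v \<in> S"
  shows "of_real (\<Lambda> (s i v)) * proj_entry M x (s i v) = T i (orth_proj M (ket v)) x"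
proof -
  have "T i (orth_proj M (ket v)) = orth_proj M (T i (ket v))"
    using commutes i ket_in_ell2[OF v] by simp
  also have "\<dots> = (\<lambda>x. of_real (\<Lambda> (s i v)) * proj_entry M x (s i v))"
    unfolding T_ket[OF i v] proj_entry_def by (rule orth_proj_scale[OF M ket_in_ell2[OF step_in[OF i v]]])
  finally show ?thesis by simp
qed

lemma proj_entry_step_weighted:
  assumes "i \<in> I" "u \<in> S" "v \<in> S"
  shows "of_real (\<Lambda> (s i v)) * proj_entry M (s i u) (s i v) = of_real (\<Lambda> (s i u)) * proj_entry M u v"
  unfolding proj_entry_T[OF assms(1,3)] T_step[OF assms(1,2) orth_proj_ell2[OF M ket_in_ell2[OF assms(3)]]]
  by (simp add: proj_entry_def)

text \<open>The column at \<open>s i v\<close> is, up to a nonzero weight, a vector in the image of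
  \<open>T i\<close>, and such vectors are supported on the range of \<open>s i\<close>.\<close>

lemma proj_entry_range:
  assumes i: "i \<in> I" and v: "v \<in> S" and n0: "proj_entry M x (s i v) \<noteq> 0"
  shows "x \<in> s i ` S"
proof (rule ccontr)
  assume "x \<notin> s i ` S"
  then have "of_real (\<Lambda> (s i v)) * proj_entry M x (s i v) = 0"
    using proj_entry_T[OF i v] T_outside[OF i orth_proj_ell2[OF M ket_in_ell2[OF v]]] by simp
  then show False using n0 weight_pos[OF step_in[OF i v]] by simp
qed

text \<open>Comparing the weighted identity for \<open>(u, v)\<close> with the conjugate of the one for \<open>(v, u)\<close>
  forces the two weights to agree.\<close>

lemma
  assumes i: "i \<in> I" and u: "u \<in> S" and v: "v \<in> S"
  shows proj_entry_step: "proj_entry M (s i u) (s i v) = proj_entry M u v"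
    and weight_eq_if_proj_entry: "proj_entry M u v \<noteq> 0 \<Longrightarrow> \<Lambda> (s i u) = \<Lambda> (s i v)"
proof -
  let ?a = "\<Lambda> (s i v)" and ?b = "\<Lambda> (s i u)"
  have pos: "0 < ?a" "0 < ?b" using i u v by (auto intro: weight_pos step_in)
  have 1: "of_real ?a * proj_entry M (s i u) (s i v) = of_real ?b * proj_entry M u v"
    by (rule proj_entry_step_weighted[OF i u v])
  have "cnj (of_real ?b * proj_entry M (s i v) (s i u)) = cnj (of_real ?a * proj_entry M v u)"
    using proj_entry_step_weighted[OF i v u] by simp
  then have 2: "of_real ?b * proj_entry M (s i u) (s i v) = of_real ?a * proj_entry M u v"
    using proj_entry_cnj[OF M u v] proj_entry_cnj[OF M step_in[OF i u] step_in[OF i v]] by simp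
  have "of_real (?a * ?a) * proj_entry M u v = of_real ?a * (of_real ?b * proj_entry M (s i u) (s i v))"
    using 2 by simp
  also have "\<dots> = of_real ?b * (of_real ?a * proj_entry M (s i u) (s i v))" by simp
  also have "\<dots> = of_real (?b * ?b) * proj_entry M u v" using 1 by simp
  finally have "proj_entry M u v = 0 \<or> ?a * ?a = ?b * ?b"
    by (metis mult_cancel_right of_real_eq_iff)
  moreover have "?a = ?b" if "?a * ?a = ?b * ?b"
    using that pos by (simp add: square_eq_iff)
  ultimately have 3: "proj_entry M u v = 0 \<or> ?a = ?b" by blast
  then show "proj_entry M u v \<noteq> 0 \<Longrightarrow> ?b = ?a" by auto
  show "proj_entry M (s i u) (s i v) = proj_entry M u v" using 1 3 pos by auto
qed

lemma trivial_if_proj_entry_scalar: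
  assumes diag: "\<And>u v. u \<in> S \<Longrightarrow> v \<in> S \<Longrightarrow> u \<noteq> v \<Longrightarrow> proj_entry M u v = 0"
    and const: "\<And>u. u \<in> S \<Longrightarrow> proj_entry M u u = c"
  shows "M = {\<lambda>_. 0} \<or> M = ell2 S"
proof -
  \<comment> \<open>The value at \<open>u\<close> is found by moving the projection onto
    \<open>ket u\<close>, which conjugates the scalar \<open>c\<close>; that \<open>c\<close> is
    real has not been established here.\<close>
  have P: "orth_proj M f = (\<lambda>u. cnj c * f u)" if f: "f \<in> ell2 S" for f
  proof
    fix u
    show "orth_proj M f u = cnj c * f u"
    proof (cases "u \<in> S")
      case True
      have ku: "orth_proj M (ket u) = (\<lambda>x. c * ket u x)"
      proof
        fix x show "orth_proj M (ket u) x = c * ket u x"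
          using diag[OF _ True, of x] const[OF True]
            ell2_zero_outside[OF orth_proj_ell2[OF M ket_in_ell2[OF True]], of x] True
          by (cases "x \<in> S"; cases "x = u") (auto simp: proj_entry_def ket_apply)
      qed
      have "orth_proj M f u = l2_inner (orth_proj M f) (ket u)" by (simp add: l2_inner_ket)
      also have "\<dots> = cnj (l2_inner (\<lambda>x. c * ket u x) f)"
        unfolding l2_inner_orth_proj[OF M f ket_in_ell2[OF True]] ku by (rule l2_inner_commute)
      also have "\<dots> = cnj c * f u"
        unfolding l2_inner_scale using l2_inner_commute[of "ket u" f] by (simp add: l2_inner_ket)
      finally show ?thesis .
    next
      case False
      then show ?thesis using f orth_proj_ell2[OF M f] by (simp add: ell2_zero_outside)
    qed
  qed
  show ?thesis
  proof (cases "c = 0")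
    case True
    then have "f = (\<lambda>_. 0)" if "f \<in> M" for f
      using P[OF closed_subspaceD(1)[OF M that]] orth_proj_self[OF M that] by simp
    then show ?thesis using closed_subspaceD(2)[OF M] by blast
  next
    case False
    have "f \<in> M" if f: "f \<in> ell2 S" for f
    proof -
      have "(\<lambda>u. inverse (cnj c) * orth_proj M f u) \<in> M"
        by (intro closed_subspaceD(4)[OF M] orth_proj_in[OF M] f)
      also have "(\<lambda>u. inverse (cnj c) * orth_proj M f u) = f"
        using False by (simp add: P[OF f] fun_eq_iff)
      finally show ?thesis .
    qed
    then show ?thesis using closed_subspaceD(1)[OF M] by blast
  qed
qed

end

end

section \<open>Sequences with mutually orthogonal translates\<close>

text \<open>At \<open>l = 0\<close> the term is \<open>1 / 0 = 0\<close>. The two half lines each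
  reduce to the series over the naturals, and they may overlap at zero.\<close>

lemma summable_int_inverse_squares: "(\<lambda>l::int. 1 / (real_of_int l)\<^sup>2) summable_on UNIV"
proof -
  let ?f = "\<lambda>l::int. 1 / (real_of_int l)\<^sup>2"
  have sq: "(\<lambda>n::nat. 1 / (real n)\<^sup>2) summable_on UNIV"
    using inverse_power_summable[of 2, where ?'a = real]
    by (subst summable_on_UNIV_nonneg_real_iff) (auto simp: inverse_eq_divide)
  have "?f summable_on range int" "?f summable_on range (\<lambda>n. - int n)"
    using sq by (auto simp: summable_on_reindex inj_on_def o_def)
  then have "?f summable_on (range int \<union> range (\<lambda>n. - int n))" by (rule summable_on_union)
  also have "range int \<union> range (\<lambda>n. - int n) = UNIV"
    by (auto simp: image_iff) (metis int_cases2)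
  finally show ?thesis .
qed

text \<open>Every finite set of integers lies in some symmetric interval, so these intervals are
  cofinal among the finite sets.\<close>

lemma has_sum_int_imp_tendsto:
  fixes f :: "int \<Rightarrow> 'a::{comm_monoid_add, topological_space}"
  assumes "(f has_sum x) UNIV"
  shows "(\<lambda>N. \<Sum>l\<in>{-int N..int N}. f l) \<longlonglongrightarrow> x"
proof -
  have "filterlim (\<lambda>N. {-int N..int N}) (finite_subsets_at_top UNIV) sequentially"
  proof (rule filterlim_finite_subsets_at_top[THEN iffD2], intro allI impI)
    fix X :: "int set" assume X: "finite X \<and> X \<subseteq> UNIV"
    obtain B where B: "\<And>l. l \<in> X \<Longrightarrow> nat \<bar>l\<bar> \<le> B"
      using X finite_nat_set_iff_bounded_le[of "(\<lambda>l. nat \<bar>l\<bar>) ` X"] by auto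
    show "\<forall>\<^sub>F N in sequentially. finite {-int N..int N} \<and> X \<subseteq> {-int N..int N} \<and> {-int N..int N} \<subseteq> UNIV"
      using eventually_ge_at_top[of B]
    proof eventually_elim
      case (elim N)
      have "l \<in> {-int N..int N}" if "l \<in> X" for l using B[OF that] elim by auto
      then show ?case by auto
    qed
  qed
  then show ?thesis
    using assms unfolding has_sum_def by (rule filterlim_compose[rotated])
qed

text \<open>Over a symmetric interval a shift by one telescopes. Induction on \<open>m\<close>
  leaves only boundary values of \<open>a\<close>, which tend to zero.\<close>

lemma telescoping_int_shift_sum:
  fixes a :: "int \<Rightarrow> real"
  assumes lim: "\<And>c. (\<lambda>N. a (int N + c)) \<longlonglongrightarrow> 0" "\<And>c. (\<lambda>N. a (c - int N)) \<longlonglongrightarrow> 0"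
    and sum: "((\<lambda>l. a (l - int m) - a l) has_sum x) UNIV"
  shows "x = 0"
proof -
  have step: "(\<Sum>l\<in>{-int N..int N}. a (l - c - 1) - a (l - c)) = a (- int N - c - 1) - a (int N - c)"
    for N c
  proof (induction N)
    case (Suc N)
    have "{-int (Suc N)..int (Suc N)} = insert (- int N - 1) (insert (int N + 1) {-int N..int N})"
      by auto
    then show ?case using Suc.IH
      by (simp add: algebra_simps) (rule arg_cong[where f = a], simp)
  qed simp
  have "(\<lambda>N. \<Sum>l\<in>{-int N..int N}. a (l - int m) - a l) \<longlonglongrightarrow> 0"
  proof (induction m)
    case (Suc m)
    have "(\<lambda>N. (\<Sum>l\<in>{-int N..int N}. a (l - int m) - a l) + (a (- int m - 1 - int N) - a (int N + - int m)))
        \<longlonglongrightarrow> 0 + (0 - 0)"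
      by (intro tendsto_add tendsto_diff Suc.IH lim)
    moreover have "(\<Sum>l\<in>{-int N..int N}. a (l - int (Suc m)) - a l)
        = (\<Sum>l\<in>{-int N..int N}. a (l - int m) - a l) + (a (- int m - 1 - int N) - a (int N + - int m))" for N
    proof -
      have "(\<Sum>l\<in>{-int N..int N}. a (l - int (Suc m)) - a l)
          = (\<Sum>l\<in>{-int N..int N}. a (l - int m) - a l) + (\<Sum>l\<in>{-int N..int N}. a (l - int m - 1) - a (l - int m))"
        unfolding sum.distrib[symmetric] by (intro sum.cong refl) (simp add: algebra_simps)
      moreover have "a (- int m - 1 - int N) = a (- int N - int m - 1)"
        by (rule arg_cong[where f = a]) simp
      ultimately show ?thesis using step[of "int m" N] by simp
    qed
    ultimately show ?case by simp
  qed simp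
  then show ?thesis using has_sum_int_imp_tendsto[OF sum] LIMSEQ_unique by blast
qed

text \<open>Up to a constant factor, the Fourier coefficients of the square wave with values 1 and
  -1 on two half circles. That wave has constant modulus, which is why distinct translates turn out
  orthogonal.\<close>

definition odd_inverse :: "int \<Rightarrow> real" where
  "odd_inverse l = (if odd l then 1 / real_of_int l else 0)"

lemma odd_inverse_minus: "odd_inverse (- l) = - odd_inverse l"
  by (simp add: odd_inverse_def)

lemma summable_odd_inverse_square: "(\<lambda>l. (odd_inverse l)\<^sup>2) summable_on UNIV"
  by (rule summable_on_comparison_test[OF summable_int_inverse_squares])
    (auto simp: odd_inverse_def power_divide)

lemma summable_odd_inverse_shift: "(\<lambda>l. odd_inverse l * odd_inverse (l - m)) summable_on UNIV"
proof -
  have "bij (\<lambda>l::int. l - m)" by (rule bij_diff_right)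
  then have "(\<lambda>l. (odd_inverse (l - m))\<^sup>2) summable_on UNIV"
    using summable_on_reindex_bij_betw[of "\<lambda>l. l - m" UNIV UNIV "\<lambda>l. (odd_inverse l)\<^sup>2"]
      summable_odd_inverse_square by simp
  then have "(\<lambda>l. (odd_inverse l)\<^sup>2 + (odd_inverse (l - m))\<^sup>2) summable_on UNIV"
    by (intro summable_on_add summable_odd_inverse_square)
  moreover have "norm (odd_inverse l * odd_inverse (l - m))
      \<le> (odd_inverse l)\<^sup>2 + (odd_inverse (l - m))\<^sup>2" for l
    using sum_squares_bound[of "\<bar>odd_inverse l\<bar>" "\<bar>odd_inverse (l - m)\<bar>"]
      mult_nonneg_nonneg[OF abs_ge_zero abs_ge_zero, of "odd_inverse l" "odd_inverse (l - m)"]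
    unfolding real_norm_def abs_mult power2_abs by linarith
  ultimately have "(\<lambda>l. norm (odd_inverse l * odd_inverse (l - m))) summable_on UNIV"
    by (rule summable_on_comparison_test) auto
  then show ?thesis by (rule abs_summable_summable)
qed

text \<open>For odd \<open>m\<close> one of \<open>l\<close> and \<open>l - m\<close> is even, so
  each product vanishes. For even \<open>m > 0\<close> the partial fractions
  \<open>m / (l * (l - m)) = 1 / (l - m) - 1 / l\<close> telescope. Negative \<open>m\<close>
  reduces to this by reindexing.\<close>

lemma infsum_odd_inverse_shift:
  assumes "m \<noteq> 0"
  shows "(\<Sum>\<^sub>\<infinity>l. odd_inverse l * odd_inverse (l - m)) = 0"
proof -
  have nat: "(\<Sum>\<^sub>\<infinity>l. odd_inverse l * odd_inverse (l - int k)) = 0" if "0 < k" for k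
  proof (cases "even k")
    case False
    then show ?thesis by (intro infsum_0) (auto simp: odd_inverse_def)
  next
    case True
    have eq: "real k * (odd_inverse l * odd_inverse (l - int k)) = odd_inverse (l - int k) - odd_inverse l"
      for l
    proof (cases "odd l")
      case odd: True
      then have "l \<noteq> 0" "l - int k \<noteq> 0" "odd (l - int k)" using True by auto
      then have "real_of_int l \<noteq> 0" "real_of_int l - real k \<noteq> 0" by linarith+
      then show ?thesis using odd \<open>odd (l - int k)\<close>
        by (simp add: odd_inverse_def divide_simps)
    next
      case False
      then show ?thesis using True by (simp add: odd_inverse_def)
    qed
    have bd: "\<bar>odd_inverse l\<bar> \<le> \<bar>1 / real_of_int l\<bar>" for l by (simp add: odd_inverse_def)
    have lim1: "(\<lambda>N. odd_inverse (int N + c)) \<longlonglongrightarrow> 0" for c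
    proof (rule Lim_null_comparison)
      show "(\<lambda>N. \<bar>1 / (real N + real_of_int c)\<bar>) \<longlonglongrightarrow> 0" by real_asymp
      show "\<forall>\<^sub>F N in sequentially. norm (odd_inverse (int N + c)) \<le> \<bar>1 / (real N + real_of_int c)\<bar>"
        using bd[of "int N + c" for N] by simp
    qed
    have lim2: "(\<lambda>N. odd_inverse (c - int N)) \<longlonglongrightarrow> 0" for c
      using tendsto_minus[OF lim1[of "- c"]] by (simp flip: odd_inverse_minus)
    have "((\<lambda>l. real k * (odd_inverse l * odd_inverse (l - int k))) has_sum
        real k * (\<Sum>\<^sub>\<infinity>l. odd_inverse l * odd_inverse (l - int k))) UNIV"
      by (intro has_sum_cmult_right has_sum_infsum summable_odd_inverse_shift)
    then have "real k * (\<Sum>\<^sub>\<infinity>l. odd_inverse l * odd_inverse (l - int k)) = 0"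
      unfolding eq by (rule telescoping_int_shift_sum[OF lim1 lim2])
    then show ?thesis using that by simp
  qed
  show ?thesis
  proof (cases "0 < m")
    case True
    then show ?thesis using nat[of "nat m"] by simp
  next
    case False
    have "(\<Sum>\<^sub>\<infinity>l. odd_inverse l * odd_inverse (l - m))
        = (\<Sum>\<^sub>\<infinity>l. odd_inverse (l + m) * odd_inverse (l + m - m))"
      by (rule infsum_reindex_bij_betw[symmetric, OF bij_plus_right])
    also have "\<dots> = (\<Sum>\<^sub>\<infinity>l. odd_inverse l * odd_inverse (l - int (nat (- m))))"
      using False by (simp add: mult.commute)
    also have "\<dots> = 0" using False assms by (intro nat) auto
    finally show ?thesis .
  qed
qed

text \<open>The sequences are the Fourier coefficients of twice the indicator functions of two
  complementary half circles.\<close>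

lemma orthogonal_translates:
  obtains c d :: "int \<Rightarrow> complex"
  where "(\<lambda>l. (cmod (c l))\<^sup>2) summable_on UNIV" "(\<lambda>l. (cmod (d l))\<^sup>2) summable_on UNIV"
    "c 0 = 1" "d 0 = 1" "\<And>m. ((\<lambda>l. c l * cnj (d (l - m))) has_sum 0) UNIV"
proof -
  define C where "C = (\<Sum>\<^sub>\<infinity>l. (odd_inverse l)\<^sup>2)"
  have "(odd_inverse 1)\<^sup>2 \<le> C"
    unfolding C_def using finite_sum_le_infsum[OF summable_odd_inverse_square, of "{1}"] by simp
  then have C: "0 < C" by (simp add: odd_inverse_def)
  \<comment> \<open>Scaled to unit norm, \<open>h\<close> has an orthonormal family of translates,
    just like the unit sequence \<open>ket 0\<close>.\<close>
  define h where "h l = odd_inverse l / sqrt C" for l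
  have h0: "h 0 = 0" "h (- l) = - h l" for l by (simp_all add: h_def odd_inverse_minus odd_inverse_def)
  have hh: "((\<lambda>l. h l * h (l - m)) has_sum (if m = 0 then 1 else 0)) UNIV" for m
  proof -
    have "((\<lambda>l. inverse C * (odd_inverse l * odd_inverse (l - m))) has_sum
        inverse C * (\<Sum>\<^sub>\<infinity>l. odd_inverse l * odd_inverse (l - m))) UNIV"
      by (intro has_sum_cmult_right has_sum_infsum summable_odd_inverse_shift)
    moreover have "inverse C * (odd_inverse l * odd_inverse (l - m)) = h l * h (l - m)" for l
      using C by (simp add: h_def field_simps)
    moreover have "inverse C * (\<Sum>\<^sub>\<infinity>l. odd_inverse l * odd_inverse (l - m)) = (if m = 0 then 1 else 0)"
      using C infsum_odd_inverse_shift[of m] by (simp add: C_def power2_eq_square)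
    ultimately show ?thesis by simp
  qed
  define c where "c l = ket (0::int) l + \<i> * of_real (h l)" for l
  define d where "d l = ket (0::int) l - \<i> * of_real (h l)" for l
  have "(\<lambda>l. (cmod (\<i> * of_real (h l)))\<^sup>2) summable_on UNIV"
    using hh[of 0] by (auto simp: has_sum_iff norm_mult power2_eq_square simp flip: abs_mult)
  then have hl: "(\<lambda>l. \<i> * of_real (h l)) \<in> ell2 UNIV" by (simp add: ell2_iff)
  have kl: "ket (0::int) \<in> ell2 UNIV" by (simp add: ket_in_ell2)
  have cd: "(\<lambda>l. (cmod (c l))\<^sup>2) summable_on UNIV" "(\<lambda>l. (cmod (d l))\<^sup>2) summable_on UNIV"
    unfolding c_def d_def using ell2_add[OF kl hl] ell2_diff[OF kl hl] by (simp_all add: ell2_iff)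
  \<comment> \<open>Expanding gives four sums: the autocorrelations of \<open>ket 0\<close> and
    \<open>h\<close> are equal and enter with opposite signs, and the two mixed terms cancel because
    \<open>h\<close> is odd.\<close>
  have sum0: "((\<lambda>l. c l * cnj (d (l - m))) has_sum 0) UNIV" for m
  proof -
    have k: "((\<lambda>l. ket (0::int) l * ket 0 (l - m)) has_sum ket 0 m) UNIV"
      by (rule has_sum_finite_neutralI[of "{0}"]) (auto simp: ket_apply)
    have k1: "((\<lambda>l. ket (0::int) l * (\<i> * of_real (h (l - m)))) has_sum \<i> * of_real (h (- m))) UNIV"
      by (rule has_sum_finite_neutralI[of "{0}"]) (auto simp: ket_apply)
    have k2: "((\<lambda>l. \<i> * of_real (h l) * ket (0::int) (l - m)) has_sum \<i> * of_real (h m)) UNIV"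
      by (rule has_sum_finite_neutralI[of "{m}"]) (auto simp: ket_apply)
    have k3: "((\<lambda>l. - complex_of_real (h l * h (l - m))) has_sum
        - of_real (if m = 0 then 1 else 0)) UNIV"
      unfolding has_sum_uminus minus_minus by (rule has_sum_of_real[OF hh])
    have "((\<lambda>l. ket (0::int) l * ket 0 (l - m) + ket (0::int) l * (\<i> * of_real (h (l - m)))
        + \<i> * of_real (h l) * ket (0::int) (l - m) + - of_real (h l * h (l - m)))
      has_sum (ket 0 m + \<i> * of_real (h (- m)) + \<i> * of_real (h m)
        + - of_real (if m = 0 then 1 else 0))) UNIV"
      by (intro has_sum_add k k1 k2 k3)
    moreover have "ket 0 m + \<i> * of_real (h (- m)) + \<i> * of_real (h m)
        + - of_real (if m = 0 then 1 else 0) = (0 :: complex)"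
      by (simp add: h0 ket_apply)
    moreover have "ket (0::int) l * ket 0 (l - m) + ket (0::int) l * (\<i> * of_real (h (l - m)))
        + \<i> * of_real (h l) * ket (0::int) (l - m) + - of_real (h l * h (l - m))
        = c l * cnj (d (l - m))" for l
    proof -
      have "cnj (ket 0 (l - m)) = ket 0 (l - m)" by (simp add: ket_apply)
      then show ?thesis by (simp add: c_def d_def algebra_simps)
    qed
    ultimately show ?thesis by simp
  qed
  show ?thesis
    by (rule that[OF cd _ _ sum0]) (simp_all add: c_def d_def ket_apply h0)
qed

section \<open>Shifts that commute with a free action of the integers\<close>

text \<open>Invariance of the weights is required at the vertices \<open>s i u\<close>, where the
  weights enter the operators.\<close>

locale periodic_tree_shift = weighted_tree_shift S I s \<Lambda> T
  for S :: "'g set" and I :: "'i set" and s and \<Lambda> and T +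
  fixes \<rho> :: "int \<Rightarrow> 'g \<Rightarrow> 'g"
  assumes act_in: "u \<in> S \<Longrightarrow> \<rho> l u \<in> S"
    and act_zero: "u \<in> S \<Longrightarrow> \<rho> 0 u = u"
    and act_add: "u \<in> S \<Longrightarrow> \<rho> k (\<rho> l u) = \<rho> (k + l) u"
    and act_free: "u \<in> S \<Longrightarrow> \<rho> l u = u \<Longrightarrow> l = 0"
    and act_step: "i \<in> I \<Longrightarrow> u \<in> S \<Longrightarrow> \<rho> l (s i u) = s i (\<rho> l u)"
    and act_weight: "i \<in> I \<Longrightarrow> u \<in> S \<Longrightarrow> \<Lambda> (\<rho> l (s i u)) = \<Lambda> (s i u)"
begin

section \<open>Vectors supported on a single orbit\<close>

lemma act_inj:
  assumes u: "u \<in> S" and eq: "\<rho> k u = \<rho> l u"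
  shows "k = l"
proof -
  have "\<rho> (k - l) u = \<rho> (- l) (\<rho> k u)" by (simp add: act_add[OF u])
  also have "\<dots> = u" unfolding eq by (simp add: act_add[OF u] act_zero[OF u])
  finally have "k - l = 0" by (rule act_free[OF u])
  then show ?thesis by simp
qed

text \<open>Freeness makes the described index unique. For \<open>u\<close> in \<open>S\<close> this
  transports \<open>c\<close> from the integers to the orbit of \<open>u\<close> and extends it by
  zero.\<close>

definition orb :: "(int \<Rightarrow> complex) \<Rightarrow> 'g \<Rightarrow> 'g \<Rightarrow> complex" where
  "orb c u x = (if x \<in> range (\<lambda>l. \<rho> l u) then c (THE l. x = \<rho> l u) else 0)"

lemma orb_act: "u \<in> S \<Longrightarrow> orb c u (\<rho> l u) = c l"
  unfolding orb_def using act_inj by (auto intro!: arg_cong[of _ _ c] the_equality)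

lemma orb_outside: "x \<notin> range (\<lambda>l. \<rho> l u) \<Longrightarrow> orb c u x = 0"
  by (simp add: orb_def)

lemma orb_self: "u \<in> S \<Longrightarrow> orb c u u = c 0"
  using orb_act[of u c 0] by (simp add: act_zero)

lemma inj_act: "u \<in> S \<Longrightarrow> inj (\<lambda>l. \<rho> l u)"
  using act_inj by (auto intro: injI)

lemma orb_ell2:
  assumes u: "u \<in> S" and c: "(\<lambda>l. (cmod (c l))\<^sup>2) summable_on UNIV"
  shows "orb c u \<in> ell2 S"
proof -
  have "(\<lambda>x. (cmod (orb c u x))\<^sup>2) summable_on range (\<lambda>l. \<rho> l u)"
    unfolding summable_on_reindex[OF inj_act[OF u]] o_def orb_act[OF u] by (rule c)
  moreover have "(\<lambda>x. (cmod (orb c u x))\<^sup>2) summable_on range (\<lambda>l. \<rho> l u)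
      \<longleftrightarrow> (\<lambda>x. (cmod (orb c u x))\<^sup>2) summable_on UNIV"
    by (rule summable_on_cong_neutral) (auto simp: orb_outside)
  moreover have "orb c u x = 0" if "x \<notin> S" for x
    using that act_in[OF u] by (intro orb_outside) auto
  ultimately show ?thesis by (simp add: ell2_iff)
qed

text \<open>The map \<open>s i\<close> carries the orbit of \<open>u\<close> equivariantly onto that
  of \<open>s i u\<close>, and the weight is constant along the latter, so the sequence
  \<open>c\<close> is preserved.\<close>

lemma orb_T:
  assumes i: "i \<in> I" and u: "u \<in> S" and c: "(\<lambda>l. (cmod (c l))\<^sup>2) summable_on UNIV"
  shows "T i (orb c u) = (\<lambda>x. of_real (\<Lambda> (s i u)) * orb c (s i u) x)"
proof
  fix x
  note o = orb_ell2[OF u c]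
  show "T i (orb c u) x = of_real (\<Lambda> (s i u)) * orb c (s i u) x"
  proof (cases "x \<in> s i ` S")
    case True
    then obtain y where y: "y \<in> S" "x = s i y" by blast
    show ?thesis
    proof (cases "y \<in> range (\<lambda>l. \<rho> l u)")
      case True
      then obtain l where l: "y = \<rho> l u" by blast
      then have "x = \<rho> l (s i u)" using y act_step[OF i u] by simp
      then show ?thesis
        using T_step[OF i y(1) o] y(2) l
        by (simp add: orb_act[OF u] orb_act[OF step_in[OF i u]] act_weight[OF i u])
    next
      case False
      have "x \<notin> range (\<lambda>l. \<rho> l (s i u))"
        using False y step_inj[OF i y(1) act_in[OF u]] by (auto simp: act_step[OF i u])
      then show ?thesis using T_step[OF i y(1) o] y False by (simp add: orb_outside)
    qed
  next
    case False
    then have "x \<notin> range (\<lambda>l. \<rho> l (s i u))" using act_in[OF u] by (auto simp: act_step[OF i u])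
    then show ?thesis using T_outside[OF i o False] by (simp add: orb_outside)
  qed
qed

lemma adj_orb_step:
  assumes i: "i \<in> I" and u: "u \<in> S"
  shows "adj i (orb c (s i u)) = (\<lambda>x. of_real (\<Lambda> (s i u)) * orb c u x)"
proof
  fix x
  show "adj i (orb c (s i u)) x = of_real (\<Lambda> (s i u)) * orb c u x"
  proof (cases "x \<in> range (\<lambda>l. \<rho> l u)")
    case True
    then obtain l where l: "x = \<rho> l u" by blast
    then have "s i x = \<rho> l (s i u)" using act_step[OF i u] by simp
    then show ?thesis
      using l act_in[OF u]
      by (simp add: adj_def orb_act[OF u] orb_act[OF step_in[OF i u]] act_weight[OF i u])
  next
    case False
    then have "s i x \<notin> range (\<lambda>l. \<rho> l (s i u))" if "x \<in> S"
      using step_inj[OF i that act_in[OF u]] by (auto simp: act_step[OF i u])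
    then show ?thesis using False by (simp add: adj_def orb_outside)
  qed
qed

text \<open>The range of \<open>s i\<close> is invariant under the action, so an orbit that starts
  outside it never meets it.\<close>

lemma adj_orb_outside:
  assumes i: "i \<in> I" and u: "u \<in> S" "u \<notin> s i ` S"
  shows "adj i (orb c u) = (\<lambda>_. 0)"
proof
  fix x
  have "s i x \<notin> range (\<lambda>l. \<rho> l u)" if x: "x \<in> S"
  proof
    assume "s i x \<in> range (\<lambda>l. \<rho> l u)"
    then obtain l where "s i x = \<rho> l u" by blast
    then have "u = \<rho> (- l) (s i x)" using u by (simp add: act_add act_zero)
    then have "u \<in> s i ` S" using act_step[OF i x] act_in[OF x] by simp
    then show False using u by blast
  qed
  then show "adj i (orb c u) x = 0" by (simp add: adj_def orb_outside)
qed

text \<open>Two orbits are equal or disjoint. In the first case the inner product is that of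
  \<open>c\<close> with a translate of \<open>d\<close>; in the second the supports do not
  meet.\<close>

lemma l2_inner_orb:
  assumes u: "u \<in> S" and w: "w \<in> S" and 0: "\<And>m. ((\<lambda>l. c l * cnj (d (l - m))) has_sum 0) UNIV"
  shows "l2_inner (orb c u) (orb d w) = 0"
proof (cases "w \<in> range (\<lambda>l. \<rho> l u)")
  case True
  then obtain m where m: "w = \<rho> m u" by blast
  have "l2_inner (orb c u) (orb d w) = (\<Sum>\<^sub>\<infinity>x\<in>range (\<lambda>l. \<rho> l u). orb c u x * cnj (orb d w x))"
    unfolding l2_inner_def by (rule infsum_cong_neutral) (auto simp: orb_outside)
  also have "\<dots> = (\<Sum>\<^sub>\<infinity>l. c l * cnj (orb d w (\<rho> l u)))"
    by (simp add: infsum_reindex[OF inj_act[OF u]] o_def orb_act[OF u])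
  also have "\<dots> = (\<Sum>\<^sub>\<infinity>l. c l * cnj (d (l - m)))"
  proof -
    have "orb d w (\<rho> l u) = d (l - m)" for l
      using orb_act[OF w, of d "l - m"] by (simp add: m act_add[OF u])
    then show ?thesis by simp
  qed
  also have "\<dots> = 0" by (rule infsumI[OF 0])
  finally show ?thesis .
next
  case False
  have "orb c u x * cnj (orb d w x) = 0" for x
  proof -
    have False if "x = \<rho> k u" "x = \<rho> l w" for k l
    proof -
      have "w = \<rho> (- l) x" using that(2) w by (simp add: act_add act_zero)
      then have "w = \<rho> (k - l) u" using that(1) u by (simp add: act_add)
      then show False using \<open>w \<notin> range (\<lambda>l. \<rho> l u)\<close> by blast
    qed
    then have "x \<notin> range (\<lambda>l. \<rho> l u) \<or> x \<notin> range (\<lambda>l. \<rho> l w)" by blast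
    then show ?thesis by (auto simp: orb_outside)
  qed
  then show ?thesis unfolding l2_inner_def by (intro infsum_0)
qed

text \<open>The family \<open>orb d u\<close> is stable, up to scalars and zero, under each
  \<open>T i\<close> and its adjoint; hence so is its orthogonal complement \<open>M\<close>. This
  contains the nonzero vector \<open>orb c u\<close> but not \<open>ket u\<close>, whose inner
  product with \<open>orb d u\<close> is nonzero.\<close>

lemma reducing_subspace_exists:
  assumes "S \<noteq> {}"
  shows "has_nontrivial_reducing_subspace S (wot_algebra S (T ` I))"
proof -
  obtain c d :: "int \<Rightarrow> complex" where
    c: "(\<lambda>l. (cmod (c l))\<^sup>2) summable_on UNIV" and d: "(\<lambda>l. (cmod (d l))\<^sup>2) summable_on UNIV"
    and one: "c 0 = 1" "d 0 = 1" and orth: "\<And>m. ((\<lambda>l. c l * cnj (d (l - m))) has_sum 0) UNIV"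
    by (rule orthogonal_translates, rule that)
  define M where "M = {f \<in> ell2 S. \<forall>g\<in>orb d ` S. l2_inner f g = 0}"
  have M: "closed_subspace S M"
    unfolding M_def by (rule closed_subspace_orthogonal) (use orb_ell2 d in blast)
  have T_M: "T i f \<in> M" if i: "i \<in> I" and f: "f \<in> M" for i f
  proof -
    have fl: "f \<in> ell2 S" using f by (simp add: M_def)
    have "l2_inner (T i f) (orb d u) = 0" if u: "u \<in> S" for u
    proof (cases "u \<in> s i ` S")
      case True
      then obtain v where v: "v \<in> S" "u = s i v" by blast
      have "l2_inner (orb d v) f = 0"
        using f v(1) l2_inner_commute[of "orb d v" f] by (simp add: M_def)
      then have "l2_inner (adj i (orb d u)) f = 0"
        unfolding v(2) adj_orb_step[OF i v(1)] l2_inner_scale by simp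
      then show ?thesis
        unfolding l2_inner_T[OF i fl] using l2_inner_commute[of f "adj i (orb d u)"] by simp
    next
      case False
      then show ?thesis
        unfolding l2_inner_T[OF i fl] adj_orb_outside[OF i u False] by (simp add: l2_inner_def)
    qed
    then show ?thesis using bounded_opsD(2)[OF T_bounded[OF i] fl] by (auto simp: M_def)
  qed
  have adj_M: "adj i g \<in> M" if i: "i \<in> I" and g: "g \<in> M" for i g
  proof -
    have gl: "g \<in> ell2 S" using g by (simp add: M_def)
    have "l2_inner (adj i g) (orb d u) = 0" if u: "u \<in> S" for u
    proof -
      have "l2_inner (orb d (s i u)) g = 0"
        using g step_in[OF i u] l2_inner_commute[of "orb d (s i u)" g] by (simp add: M_def)
      then have "l2_inner (T i (orb d u)) g = 0"
        unfolding orb_T[OF i u d] l2_inner_scale by simp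
      then show ?thesis
        unfolding l2_inner_T[OF i orb_ell2[OF u d]]
        using l2_inner_commute[of "adj i g" "orb d u"] by simp
    qed
    then show ?thesis using adj_ell2[OF i gl] by (auto simp: M_def)
  qed
  \<comment> \<open>Invariance under \<open>T i\<close> puts the image of the projection in
    \<open>M\<close>; invariance under the adjoint makes the image of the residual orthogonal to
    \<open>M\<close>.\<close>
  have "T i \<in> proj_commutant S M" if i: "i \<in> I" for i
  proof -
    have "orth_proj M (T i f) = T i (orth_proj M f)" if f: "f \<in> ell2 S" for f
    proof (rule orth_proj_eqI[OF M bounded_opsD(2)[OF T_bounded[OF i] f] T_M[OF i orth_proj_in[OF M f]]])
      fix g assume g: "g \<in> M"
      note P = orth_proj_ell2[OF M f]
      have "l2_inner (\<lambda>u. T i f u - T i (orth_proj M f) u) g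
          = l2_inner (T i f) g - l2_inner (T i (orth_proj M f)) g"
        by (intro l2_inner_diff[of _ S] bounded_opsD(2)[OF T_bounded[OF i]] f P closed_subspaceD(1)[OF M g])
      also have "\<dots> = l2_inner f (adj i g) - l2_inner (orth_proj M f) (adj i g)"
        by (simp add: l2_inner_T[OF i f] l2_inner_T[OF i P])
      also have "\<dots> = l2_inner (\<lambda>u. f u - orth_proj M f u) (adj i g)"
        by (intro l2_inner_diff[symmetric, of _ S] f P closed_subspaceD(1)[OF M adj_M[OF i g]])
      also have "\<dots> = 0" by (rule orth_proj_orthogonal[OF M f adj_M[OF i g]])
      finally show "l2_inner (\<lambda>u. T i f u - T i (orth_proj M f) u) g = 0" .
    qed
    then show ?thesis using T_bounded[OF i] by (simp add: proj_commutant_def)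
  qed
  then have "reduces S M (wot_algebra S (T ` I))" by (intro reduces_wot_algebraI[OF M]) blast
  moreover obtain u where u: "u \<in> S" using assms by blast
  have "orb c u \<in> M" using orb_ell2[OF u c] l2_inner_orb[OF u _ orth] by (auto simp: M_def)
  moreover have "orb c u \<noteq> (\<lambda>_. 0)" using orb_self[OF u, of c] one by auto
  moreover have "ket u \<notin> M"
  proof
    assume "ket u \<in> M"
    then have "l2_inner (ket u) (orb d u) = 0" using u by (auto simp: M_def)
    then have "orb d u u = 0" using l2_inner_commute[of "ket u" "orb d u"] by (simp add: l2_inner_ket)
    then show False using orb_self[OF u] one by simp
  qed
  ultimately show ?thesis
    unfolding has_nontrivial_reducing_subspace_def using ket_in_ell2[OF u] by blast
qed

end

section \<open>The tree of group elements over a periodic word\<close>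

lemma pos_append: "pos (v @ w) = pos v \<otimes>\<^bsub>free_group n\<^esub> pos w"
proof -
  have cons: "cancel_Cons (i, True) (pos u) = pos (i # u)" for i u
    by (cases u) (auto simp: pos_def inv_letter_def)
  have "foldr cancel_Cons (pos v) (pos w) = pos (v @ w)"
  proof (induction v)
    case (Cons i v)
    have "foldr cancel_Cons (pos (i # v)) (pos w) = cancel_Cons (i, True) (foldr cancel_Cons (pos v) (pos w))"
      by (simp add: pos_def)
    then show ?case unfolding Cons cons by simp
  qed (simp add: pos_def)
  then show ?thesis by (simp add: free_group_def)
qed

lemma pos_carrier: "v \<in> free_semigroup n \<Longrightarrow> pos v \<in> carrier (free_group n)"
proof -
  have "reduced_word (pos v)"
    by (auto simp: reduced_word_def pos_def successively_map inv_letter_def successively_conv_nth)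
  then show "v \<in> free_semigroup n \<Longrightarrow> ?thesis"
    by (auto simp: free_group_def pos_def)
qed

lemma pos_inj: "pos v = pos w \<longleftrightarrow> v = w"
  unfolding pos_def by (rule inj_map_eq_map) (auto intro: injI)

text \<open>Strong induction on the position: beyond \<open>v\<close>, both equations refer back to
  a position smaller by \<open>length v\<close>.\<close>

lemma stream_eq_if_shift_fixpoints:
  assumes "v \<noteq> []" "s = v @- s" "t = v @- t"
  shows "s = t"
proof -
  have "s !! j = t !! j" for j
  proof (induction j rule: less_induct)
    case (less j)
    show ?case
    proof (cases "j < length v")
      case True
      then show ?thesis using assms(2,3) by (metis shift_snth_less)
    next
      case False
      then have "s !! j = s !! (j - length v)" "t !! j = t !! (j - length v)"
        using assms(2,3) by (metis not_less shift_snth_ge)+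
      moreover have "j - length v < j" using False assms(1) by (cases v) auto
      ultimately show ?thesis using less by simp
    qed
  qed
  then have "snth s = snth t" by (rule ext)
  then show ?thesis using stream_smap_nats[of s] stream_smap_nats[of t] by simp
qed

lemma cycle_concat_replicate:
  assumes "u \<noteq> []" "0 < k"
  shows "cycle (concat (replicate k u)) = cycle u"
proof (rule stream_eq_if_shift_fixpoints)
  let ?v = "concat (replicate k u)"
  show v: "?v \<noteq> []" using assms by (cases k) auto
  show "cycle ?v = ?v @- cycle ?v" by (rule cycle_decomp[OF v])
  show "cycle u = ?v @- cycle u"
  proof (induction k)
    case (Suc k)
    then show ?case using cycle_decomp[OF assms(1)] by simp
  qed simp
qed

text \<open>A shortest word generating \<open>\<omega>\<close> is primitive, since the base of a
  proper power would be a shorter generator.\<close>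

lemma periodic_word_primitive:
  assumes "periodic_word n \<omega>"
  obtains v where "primitive n v" "\<omega> = cycle v"
proof -
  let ?P = "\<lambda>v. v \<in> free_semigroup n \<and> v \<noteq> [] \<and> \<omega> = cycle v"
  obtain v where v: "?P v" and min: "\<And>u. ?P u \<Longrightarrow> length v \<le> length u"
    using assms ex_has_least_nat[of ?P _ length] unfolding periodic_word_def by blast
  have "v \<noteq> concat (replicate k u)" if "u \<in> free_semigroup n" "2 \<le> k" for u k
  proof
    assume eq: "v = concat (replicate k u)"
    then have "u \<noteq> []" using v by auto
    moreover from this have "\<omega> = cycle u" using v eq that cycle_concat_replicate[of u k] by simp
    ultimately have "length v \<le> length u" using that by (intro min) simp
    moreover have "length v = k * length u" unfolding eq by (simp add: length_concat sum_list_replicate)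
    ultimately have "k * length u \<le> 1 * length u" by simp
    then show False using \<open>u \<noteq> []\<close> that by (simp only: mult_le_cancel2) auto
  qed
  then show ?thesis using v that[of v] by (auto simp: primitive_def)
qed

section \<open>Products of a word with the inverse of a prefix\<close>

locale infinite_word =
  fixes n :: enat and \<omega> :: "nat stream"
  assumes word: "\<omega> \<in> streams (letters n)"
begin

sublocale FG: group "free_group n"
  by (rule group_free_group)

abbreviation G where "G \<equiv> free_group n"

text \<open>Pairs \<open>(y, m)\<close> replace reduced words. Several pairs may name one group
  element; \<open>el_eq_iff\<close> decides when they do.\<close>

definition el :: "nat list \<Rightarrow> nat \<Rightarrow> group_word" where
  "el y m = pos y \<otimes>\<^bsub>G\<^esub> inv\<^bsub>G\<^esub> pos (stake m \<omega>)"

lemma letter_in: "\<omega> !! m \<in> letters n"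
  using word by (rule snth_in)

lemma stake_in: "stake m (sdrop k \<omega>) \<in> free_semigroup n"
  by (auto simp: in_set_conv_nth stake_nth sdrop_snth letter_in)

lemma prefix_in: "stake m \<omega> \<in> free_semigroup n"
  using stake_in[of m 0] by simp

lemmas pos_closed = pos_carrier[of _ n] pos_carrier[OF prefix_in] pos_carrier[OF stake_in]

lemma el_closed: "y \<in> free_semigroup n \<Longrightarrow> el y m \<in> carrier G"
  by (simp add: el_def pos_closed)

lemma F_omega_eq: "F_omega n \<omega> = {el y m | y m. y \<in> free_semigroup n}"
  by (auto simp: F_omega_def el_def)

lemma el_in_F: "y \<in> free_semigroup n \<Longrightarrow> el y m \<in> F_omega n \<omega>"
  by (auto simp: F_omega_eq)

lemma F_closed: "u \<in> F_omega n \<omega> \<Longrightarrow> u \<in> carrier G"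
  by (auto simp: F_omega_eq intro!: el_closed)

lemma lmul_el:
  assumes "i \<in> letters n" "y \<in> free_semigroup n"
  shows "lmul n i (el y m) = el (i # y) m"
  using assms pos_append[of "[i]" y n]
  by (simp add: lmul_def el_def pos_closed FG.m_assoc)

text \<open>The appended letters cancel against the end of the longer prefix. The word length and
  \<open>m\<close> can thus be raised together, which aligns the representations of two
  elements.\<close>

lemma el_extend:
  assumes y: "y \<in> free_semigroup n"
  shows "el (y @ stake k (sdrop m \<omega>)) (m + k) = el y m"
proof -
  let ?s = "pos (stake k (sdrop m \<omega>))" and ?w = "pos (stake m \<omega>)"
  have "el (y @ stake k (sdrop m \<omega>)) (m + k) = (pos y \<otimes>\<^bsub>G\<^esub> ?s) \<otimes>\<^bsub>G\<^esub> inv\<^bsub>G\<^esub> (?w \<otimes>\<^bsub>G\<^esub> ?s)"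
    unfolding el_def stake_add[symmetric] pos_append[of _ _ n] ..
  also have "\<dots> = el y m"
  proof -
    have "?s \<otimes>\<^bsub>G\<^esub> (inv\<^bsub>G\<^esub> ?s \<otimes>\<^bsub>G\<^esub> inv\<^bsub>G\<^esub> ?w) = inv\<^bsub>G\<^esub> ?w"
      by (simp add: pos_closed flip: FG.m_assoc)
    then show ?thesis using y by (simp add: el_def FG.inv_mult_group FG.m_assoc pos_closed)
  qed
  finally show ?thesis .
qed

lemma el_snoc:
  assumes y: "y \<in> free_semigroup n"
  shows "el (y @ [\<omega> !! m]) (Suc m) = el y m"
  using el_extend[OF y, of 1 m] by simp

lemma el_eq_same:
  assumes "y \<in> free_semigroup n" "y' \<in> free_semigroup n"
  shows "el y m = el y' m \<longleftrightarrow> y = y'"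
  using assms by (simp add: el_def pos_closed pos_inj)

text \<open>Raising the smaller index to \<open>m'\<close> and cancelling the common right factor
  leaves an equation between positive words.\<close>

lemma el_eq_iff:
  assumes y: "y \<in> free_semigroup n" and y': "y' \<in> free_semigroup n" and "m \<le> m'"
  shows "el y m = el y' m' \<longleftrightarrow> y' = y @ stake (m' - m) (sdrop m \<omega>)"
proof -
  have "y @ stake (m' - m) (sdrop m \<omega>) \<in> free_semigroup n" using y stake_in[of "m' - m" m] by simp
  then have "el (y @ stake (m' - m) (sdrop m \<omega>)) m' = el y' m' \<longleftrightarrow> y @ stake (m' - m) (sdrop m \<omega>) = y'"
    using y' by (rule el_eq_same)
  then show ?thesis using el_extend[OF y, of "m' - m" m] \<open>m \<le> m'\<close> by auto
qed

lemma F_omegaE: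
  assumes "u \<in> F_omega n \<omega>"
  obtains y m where "N \<le> m" "N \<le> length y" "y \<in> free_semigroup n" "u = el y m"
proof -
  obtain y m where u: "y \<in> free_semigroup n" "u = el y m" using assms by (auto simp: F_omega_eq)
  show ?thesis
  proof (rule that)
    show "u = el (y @ stake N (sdrop m \<omega>)) (m + N)" using el_extend[OF u(1)] u(2) by simp
    show "y @ stake N (sdrop m \<omega>) \<in> free_semigroup n" using u stake_in[of N m] by simp
  qed simp_all
qed

lemma lmul_in_F:
  assumes "i \<in> letters n" "u \<in> F_omega n \<omega>"
  shows "lmul n i u \<in> F_omega n \<omega>"
proof -
  obtain y m where y: "y \<in> free_semigroup n" "u = el y m" using assms by (auto simp: F_omega_eq)
  then have "lmul n i u = el (i # y) m" using assms(1) by (simp add: lmul_el)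
  then show ?thesis using y assms(1) el_in_F[of "i # y" m] by simp
qed

lemma letter_closed: "i \<in> letters n \<Longrightarrow> pos [i] \<in> carrier G"
  by (simp add: pos_closed)

lemma lmul_inj:
  assumes "i \<in> letters n" "u \<in> F_omega n \<omega>" "v \<in> F_omega n \<omega>" "lmul n i u = lmul n i v"
  shows "u = v"
  using assms by (simp add: lmul_def letter_closed F_closed)

text \<open>Once the representations are aligned, \<open>i\<close> and \<open>j\<close> are first
  letters of the same word. Together with \<open>lmul_inj\<close> this makes parents in the tree
  unique.\<close>

lemma lmul_letter_eq:
  assumes "i \<in> letters n" "j \<in> letters n" "u \<in> F_omega n \<omega>" "v \<in> F_omega n \<omega>"
    and eq: "lmul n i u = lmul n j v"
  shows "i = j"
proof -
  obtain y m where u: "y \<in> free_semigroup n" "u = el y m" using assms by (auto simp: F_omega_eq)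
  obtain y' m' where v: "m \<le> m'" "y' \<in> free_semigroup n" "v = el y' m'"
    by (rule F_omegaE[OF assms(4), of m], rule that)
  have "j # y' = (i # y) @ stake (m' - m) (sdrop m \<omega>)"
    using eq assms(1,2) u v by (subst el_eq_iff[symmetric]) (simp_all add: lmul_el)
  then show ?thesis by simp
qed

end

section \<open>Right multiplication by powers of the repeated word\<close>

locale periodic_infinite_word = infinite_word +
  fixes v0 :: "nat list" and k :: nat
  assumes v0: "v0 \<in> free_semigroup n" "v0 \<noteq> []" and cycle: "\<omega> = cycle v0" and k_pos: "1 \<le> k"
begin

definition g where "g = pos v0 [^]\<^bsub>G\<^esub> k"

abbreviation K where "K \<equiv> k * length v0"

lemma K_pos: "0 < K"
  using v0 k_pos by simp

lemma sdrop_mult_length: "sdrop (j * length v0) \<omega> = \<omega>"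
  unfolding cycle using v0(2) by simp

lemma snth_add_mult: "\<omega> !! (m + j * length v0) = \<omega> !! m"
proof -
  have "\<omega> !! (m + j * length v0) = sdrop (j * length v0) \<omega> !! m" by (simp add: sdrop_snth add.commute)
  then show ?thesis by (simp add: sdrop_mult_length)
qed

lemma g_eq: "g = pos (stake K \<omega>)"
proof -
  have "pos v0 [^]\<^bsub>G\<^esub> j = pos (concat (replicate j v0))" for j :: nat
  proof (induction j)
    case 0
    show ?case by (simp add: pos_def free_group_def)
  next
    case (Suc j)
    then show ?case
      by (simp only: FG.nat_pow_Suc2[OF pos_carrier[OF v0(1)]] replicate_Suc concat.simps pos_append[of _ _ n])
  qed
  then show ?thesis unfolding g_def cycle using v0(2) by simp
qed

lemma g_closed: "g \<in> carrier G"
  unfolding g_eq by (rule pos_closed)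

definition act :: "int \<Rightarrow> group_word \<Rightarrow> group_word" where
  "act l u = u \<otimes>\<^bsub>G\<^esub> g [^]\<^bsub>G\<^esub> l"

lemma act_add: "u \<in> carrier G \<Longrightarrow> act a (act b u) = act (a + b) u"
  by (simp add: act_def FG.m_assoc g_closed add.commute flip: FG.int_pow_mult)

lemma act_zero: "u \<in> carrier G \<Longrightarrow> act 0 u = u"
  by (simp add: act_def)

text \<open>By periodicity the prefix of length \<open>K + m\<close> is the word of \<open>g\<close>
  followed by the prefix of length \<open>m\<close>, so multiplying by \<open>g\<close> cancels the
  last factor of its inverse.\<close>

lemma el_act_one:
  assumes y: "y \<in> free_semigroup n"
  shows "act 1 (el y (m + K)) = el y m"
proof -
  let ?w = "pos (stake m \<omega>)"
  have "stake (K + m) \<omega> = stake K \<omega> @ stake m \<omega>"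
    using stake_add[of K \<omega> m] by (simp add: sdrop_mult_length)
  then have "el y (m + K) = pos y \<otimes>\<^bsub>G\<^esub> inv\<^bsub>G\<^esub> (g \<otimes>\<^bsub>G\<^esub> ?w)"
    unfolding el_def g_eq add.commute[of m K] by (simp only: pos_append[of _ _ n])
  then have "el y (m + K) \<otimes>\<^bsub>G\<^esub> g = pos y \<otimes>\<^bsub>G\<^esub> inv\<^bsub>G\<^esub> ?w \<otimes>\<^bsub>G\<^esub> (inv\<^bsub>G\<^esub> g \<otimes>\<^bsub>G\<^esub> g)"
    using y by (simp add: FG.inv_mult_group FG.m_assoc pos_closed g_closed del: FG.l_inv)
  then show ?thesis using y by (simp add: act_def g_closed el_def pos_closed)
qed

lemma el_act_nat:
  assumes y: "y \<in> free_semigroup n"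
  shows "act (int l) (el y (m + l * K)) = el y m"
proof (induction l arbitrary: m)
  case 0
  show ?case by (simp add: act_zero el_closed y)
next
  case (Suc l)
  have "act (int (Suc l)) (el y (m + Suc l * K)) = act (int l) (act 1 (el y (m + l * K + K)))"
    using y by (simp add: act_add el_closed algebra_simps)
  then show ?case using Suc y by (simp add: el_act_one)
qed

lemma el_act_minus:
  assumes y: "y \<in> free_semigroup n"
  shows "act (- int l) (el y m) = el y (m + l * K)"
proof -
  have "act (- int l) (el y m) = act (- int l) (act (int l) (el y (m + l * K)))"
    by (simp only: el_act_nat[OF y])
  then show ?thesis using y by (simp add: act_add act_zero el_closed)
qed

lemma act_in_F:
  assumes "u \<in> F_omega n \<omega>"
  shows "act l u \<in> F_omega n \<omega>"
proof -
  \<comment> \<open>A positive \<open>l\<close> lowers the index by \<open>l * K\<close>, so it must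
    first be large enough. For negative \<open>l\<close> the bound is void because
    \<open>nat l = 0\<close>.\<close>
  obtain y m where u: "nat l * K \<le> m" "y \<in> free_semigroup n" "u = el y m"
    by (rule F_omegaE[OF assms, of "nat l * K"], rule that)
  show ?thesis
  proof (cases "0 \<le> l")
    case True
    then have "act l u = el y (m - nat l * K)"
      using el_act_nat[OF u(2), of "nat l" "m - nat l * K"] u by simp
    then show ?thesis using u by (simp add: el_in_F)
  next
    case False
    then show ?thesis using el_act_minus[OF u(2), of "nat (- l)" m] u by (simp add: el_in_F)
  qed
qed

lemma act_free:
  assumes "u \<in> carrier G" "act l u = u"
  shows "l = 0"
proof -
  have "g [^]\<^bsub>G\<^esub> l = \<one>\<^bsub>G\<^esub>" using assms g_closed by (simp add: act_def FG.r_cancel_one)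
  then have "g [^]\<^bsub>G\<^esub> (- l) = \<one>\<^bsub>G\<^esub>" using g_closed by (simp add: FG.int_pow_neg)
  \<comment> \<open>With both signs of the exponent available, the action can be taken in the
    direction that lengthens the inverted prefix; its length must then be zero.\<close>
  then have "act (- int (nat \<bar>l\<bar>)) (el [] 0) = el [] 0"
    using \<open>g [^]\<^bsub>G\<^esub> l = \<one>\<^bsub>G\<^esub>\<close> el_closed[of "[]" 0] by (cases "0 \<le> l") (simp_all add: act_def)
  then have "el [] 0 = el [] (nat \<bar>l\<bar> * K)"
    using el_act_minus[of "[]" "nat \<bar>l\<bar>" 0] by simp
  then have "stake (nat \<bar>l\<bar> * K) \<omega> = []" by (subst (asm) el_eq_iff) auto
  then have "nat \<bar>l\<bar> * K = 0" by simp
  then show ?thesis using K_pos by simp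
qed

lemma act_lmul:
  assumes "i \<in> letters n" "u \<in> carrier G"
  shows "act l (lmul n i u) = lmul n i (act l u)"
  using assms by (simp add: act_def lmul_def FG.m_assoc letter_closed g_closed)

section \<open>Blocks and their representatives\<close>

lemma J_block_iff: "x \<in> J_block n v0 k u \<longleftrightarrow> (\<exists>l. x = act l u)"
  by (auto simp: J_block_def J_phi_def l_coset_def act_def g_def)

lemma F_period_iff:
  "u \<in> F_period n \<omega> v0 k \<longleftrightarrow> (\<exists>v m. u = el v m \<and> v \<in> free_semigroup n \<and> m < K \<and>
    (\<forall>w\<in>free_semigroup n. v \<noteq> w @ [cyc_letter \<omega> v0 m]))"
  unfolding F_period_def el_def by blast

lemma F_period_closed: "u \<in> F_period n \<omega> v0 k \<Longrightarrow> u \<in> carrier G"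
  unfolding F_period_iff using el_closed by blast

lemma block_rep_act:
  assumes x: "x \<in> carrier G"
  shows "block_rep n \<omega> v0 k (act l x) = block_rep n \<omega> v0 k x"
proof -
  have "act l x \<in> J_block n v0 k u \<longleftrightarrow> x \<in> J_block n v0 k u" if u: "u \<in> F_period n \<omega> v0 k" for u
  proof -
    have uc: "u \<in> carrier G" by (rule F_period_closed[OF u])
    show ?thesis
    proof
      assume "act l x \<in> J_block n v0 k u"
      then obtain a where "act l x = act a u" by (auto simp: J_block_iff)
      then have "act (- l) (act l x) = act (- l) (act a u)" by simp
      then show "x \<in> J_block n v0 k u" using x uc by (auto simp: J_block_iff act_add act_zero)
    next
      assume "x \<in> J_block n v0 k u"
      then show "act l x \<in> J_block n v0 k u" using uc by (auto simp: J_block_iff act_add)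
    qed
  qed
  then show ?thesis unfolding block_rep_def by (intro arg_cong[of _ _ The] ext) blast
qed

text \<open>The convention \<open>i_0 = i_|v0|\<close> makes \<open>cyc_letter\<close> the letter
  ending every nonempty prefix whose length is \<open>m\<close> plus a multiple of
  \<open>length v0\<close>; the \<open>- 1\<close> is due to counting stream positions from
  zero.\<close>

lemma cyc_letter_eq:
  assumes "0 < m + l * length v0"
  shows "cyc_letter \<omega> v0 m = \<omega> !! (m + l * length v0 - 1)"
proof (cases m)
  case 0
  with assms have "l * length v0 - 1 = length v0 - 1 + (l - 1) * length v0"
    using v0(2) by (cases l; cases v0) auto
  then show ?thesis using 0 snth_add_mult[of "length v0 - 1" "l - 1"] by (simp add: cyc_letter_def)
next
  case (Suc m')
  then show ?thesis using snth_add_mult[of m' l] by (simp add: cyc_letter_def)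
qed

text \<open>Among all pairs representing elements of the orbit, one with a shortest word is chosen
  and its index reduced modulo \<open>K\<close>. A last letter equal to the forbidden one could be
  stripped, giving a shorter word.\<close>

lemma F_period_block_exists:
  assumes x: "x \<in> F_omega n \<omega>"
  shows "\<exists>u\<in>F_period n \<omega> v0 k. \<exists>l. u = act l x"
proof -
  let ?P = "\<lambda>y. y \<in> free_semigroup n \<and> (\<exists>m l. el y m = act l x)"
  have "\<exists>y. ?P y"
  proof -
    obtain y m where "y \<in> free_semigroup n" "x = el y m" using x by (auto simp: F_omega_eq)
    moreover have "x = act 0 x" by (rule act_zero[OF F_closed[OF x], symmetric])
    ultimately show ?thesis by metis
  qed
  then obtain y where y: "?P y" and min: "\<And>z. ?P z \<Longrightarrow> length y \<le> length z"
    using ex_has_least_nat[of ?P _ length] by blast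
  obtain m l where ml: "el y m = act l x" using y by blast
  let ?r = "m mod K" and ?l = "int (m div K) + l"
  note xc = F_closed[OF x]
  have r: "el y ?r = act ?l x"
  proof -
    have "el y ?r = act (int (m div K)) (el y m)"
      using el_act_nat[of y "m div K" ?r] y by (simp only: mod_div_mult_eq)
    then show ?thesis unfolding ml using xc by (simp add: act_add)
  qed
  have False if w: "w \<in> free_semigroup n" "y = w @ [cyc_letter \<omega> v0 ?r]" for w
  proof -
    \<comment> \<open>The residue may be 0; one full period is added before the last letter is
      cancelled so that the index can drop by one.\<close>
    have m: "el y (?r + K) = act (- 1 + ?l) x"
      using el_act_minus[of y 1 ?r] y r xc by (simp add: act_add)
    have "cyc_letter \<omega> v0 ?r = \<omega> !! (?r + K - 1)" using K_pos by (intro cyc_letter_eq) simp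
    then have "el w (?r + K - 1) = el y (?r + K)"
      using el_snoc[OF w(1), of "?r + K - 1"] w K_pos by simp
    then have "?P w" using w m by metis
    then show False using min[of w] w by simp
  qed
  then have "\<forall>w\<in>free_semigroup n. y \<noteq> w @ [cyc_letter \<omega> v0 ?r]" by blast
  moreover have "?r < K" using K_pos by simp
  ultimately have "el y ?r \<in> F_period n \<omega> v0 k" using y unfolding F_period_iff by blast
  then show ?thesis using r by blast
qed

text \<open>If \<open>l > 0\<close>, then \<open>m' < K \<le> m + l * K\<close>, so equality of the
  elements makes \<open>y\<close> a proper extension of \<open>z\<close> by letters of
  \<open>\<omega>\<close>. Its last letter is then the one excluded in
  \<open>F_period\<close>.\<close>

lemma F_period_unique_aux:
  assumes u: "u \<in> F_period n \<omega> v0 k" and v: "v \<in> F_period n \<omega> v0 k" and eq: "v = act (- int l) u"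
  shows "u = v"
proof (cases "l = 0")
  case True
  then show ?thesis using eq by (simp add: act_zero F_period_closed[OF u])
next
  case False
  obtain y m where y: "u = el y m" "y \<in> free_semigroup n" "m < K"
    and ny: "\<forall>w\<in>free_semigroup n. y \<noteq> w @ [cyc_letter \<omega> v0 m]"
    using u unfolding F_period_iff by blast
  obtain z m' where z: "v = el z m'" "z \<in> free_semigroup n" "m' < K"
    using v by (auto simp: F_period_iff)
  have "K \<le> l * K" using False by (cases l) auto
  then have le: "m' < m + l * K" using z(3) by linarith
  have "el z m' = el y (m + l * K)" using eq y z by (simp add: el_act_minus)
  then have yz: "y = z @ stake (m + l * K - m') (sdrop m' \<omega>)" using y z le by (subst (asm) el_eq_iff) auto
  obtain d where d: "m + l * K - m' = Suc d" using le by (metis Suc_pred zero_less_diff)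
  have "y = (z @ stake d (sdrop m' \<omega>)) @ [\<omega> !! (m' + d)]"
    unfolding yz d stake_Suc by (simp add: sdrop_snth add.commute)
  also have "m' + d = m + l * k * length v0 - 1" using d by (simp add: mult.assoc)
  also have "\<omega> !! (m + l * k * length v0 - 1) = cyc_letter \<omega> v0 m"
  proof (rule cyc_letter_eq[symmetric])
    have "0 < m + l * K" using le by linarith
    then show "0 < m + l * k * length v0" by (simp only: mult.assoc)
  qed
  finally have "y = (z @ stake d (sdrop m' \<omega>)) @ [cyc_letter \<omega> v0 m]" .
  moreover have "z @ stake d (sdrop m' \<omega>) \<in> free_semigroup n" using z(2) stake_in[of d m'] by simp
  ultimately show ?thesis using ny by blast
qed

lemma block_rep_eq_act:
  assumes x: "x \<in> F_omega n \<omega>"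
  shows "\<exists>l. block_rep n \<omega> v0 k x = act l x"
proof -
  note xc = F_closed[OF x]
  obtain u l where u: "u \<in> F_period n \<omega> v0 k" "u = act l x"
    using F_period_block_exists[OF x] by blast
  have "block_rep n \<omega> v0 k x = u"
    unfolding block_rep_def
  proof (rule the_equality)
    have "x = act (- l) u" using u xc by (simp add: act_add act_zero)
    then show "u \<in> F_period n \<omega> v0 k \<and> x \<in> J_block n v0 k u" using u by (auto simp: J_block_iff)
    fix v assume v: "v \<in> F_period n \<omega> v0 k \<and> x \<in> J_block n v0 k v"
    then obtain a where "x = act a v" by (auto simp: J_block_iff)
    then have uv: "u = act (l + a) v" using u(2) v F_period_closed by (simp add: act_add)
    then have vu: "v = act (- (l + a)) u" using v F_period_closed by (simp add: act_add act_zero)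
    show "v = u"
    \<comment> \<open>The auxiliary lemma treats one direction of the action, so the sign decides
      which representative takes which role.\<close>
    proof (cases "0 \<le> l + a")
      case True
      then show ?thesis using F_period_unique_aux[of u v "nat (l + a)"] u v vu by simp
    next
      case False
      then have "- int (nat (- (l + a))) = l + a" by simp
      with uv have "u = act (- int (nat (- (l + a)))) v" by simp
      then show ?thesis using F_period_unique_aux[of v u] u v by blast
    qed
  qed
  then show ?thesis using u by blast
qed

text \<open>Raising the index by \<open>K\<close> is the action of -1. The hypothesis therefore
  gives invariance along whole orbits, in which the block representatives lie.\<close>

lemma weights_of_period_if:
  assumes "\<And>y m. y \<in> free_semigroup n \<Longrightarrow> \<Lambda> (el y m) = \<Lambda> (el y (m + K))"
  shows "weights_of_period n \<omega> v0 k \<Lambda>"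
proof -
  have el: "\<Lambda> (el y m) = \<Lambda> (el y (m + l * K))" if "y \<in> free_semigroup n" for y m l
  proof (induction l)
    case (Suc l)
    then show ?case using assms[OF that, of "m + l * K"] by (simp add: algebra_simps)
  qed simp
  have neg: "\<Lambda> (act (- int l) x) = \<Lambda> x" if x: "x \<in> F_omega n \<omega>" for l x
  proof -
    obtain y m where "y \<in> free_semigroup n" "x = el y m" using x by (auto simp: F_omega_eq)
    then show ?thesis using el[of y m l] by (simp add: el_act_minus)
  qed
  have act: "\<Lambda> (act l x) = \<Lambda> x" if x: "x \<in> F_omega n \<omega>" for l x
  proof (cases "0 \<le> l")
    case True
    then show ?thesis
      using neg[OF act_in_F[OF x], of "nat l" l] F_closed[OF x] by (simp add: act_add act_zero)
  next
    case False
    then show ?thesis using neg[OF x, of "nat (- l)"] by simp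
  qed
  show ?thesis
    unfolding weights_of_period_def using act block_rep_eq_act lmul_in_F by metis
qed

text \<open>Elements of one orbit have the same block representative, to whose weight both sides are
  equal.\<close>

lemma weight_act:
  assumes "weights_of_period n \<omega> v0 k \<Lambda>" and i: "i \<in> letters n" and u: "u \<in> F_omega n \<omega>"
  shows "\<Lambda> (act l (lmul n i u)) = \<Lambda> (lmul n i u)"
proof -
  have "\<Lambda> (act l (lmul n i u)) = \<Lambda> (block_rep n \<omega> v0 k (act l (lmul n i u)))"
    unfolding act_lmul[OF i F_closed[OF u]]
    using assms(1) i act_in_F[OF u] unfolding weights_of_period_def by blast
  also have "\<dots> = \<Lambda> (lmul n i u)"
    unfolding block_rep_act[OF F_closed[OF lmul_in_F[OF i u]]]
    using assms(1) i u unfolding weights_of_period_def by metis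
  finally show ?thesis .
qed

end

section \<open>The equivalence\<close>

context infinite_word
begin

lemma weighted_tree_shift:
  assumes "\<forall>u\<in>F_omega n \<omega>. 0 < \<Lambda> u" "weighted_shift n \<omega> \<Lambda> T"
  shows "weighted_tree_shift (F_omega n \<omega>) (letters n) (lmul n) \<Lambda> T"
  using assms lmul_in_F lmul_inj by unfold_locales (auto simp: weighted_shift_def)

lemma reducing_imp_weights_invariant:
  assumes shift: "weighted_tree_shift (F_omega n \<omega>) (letters n) (lmul n) \<Lambda> T"
    and red: "has_nontrivial_reducing_subspace (F_omega n \<omega>) (shift_algebra n \<omega> T)"
  obtains a d where "0 < d"
    "\<And>y m. y \<in> free_semigroup n \<Longrightarrow> y \<noteq> [] \<Longrightarrow> a \<le> m \<Longrightarrow> \<Lambda> (el y m) = \<Lambda> (el y (m + d))"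
proof -
  interpret weighted_tree_shift "F_omega n \<omega>" "letters n" "lmul n" \<Lambda> T by (rule shift)
  obtain M where M: "reduces (F_omega n \<omega>) M (shift_algebra n \<omega> T)"
    and nontrivial: "M \<noteq> {\<lambda>_. 0}" "M \<noteq> ell2 (F_omega n \<omega>)"
    using red by (auto simp: has_nontrivial_reducing_subspace_def)
  have closed: "closed_subspace (F_omega n \<omega>) M" using M by (simp add: reduces_def)
  have commutes: "\<forall>i\<in>letters n. \<forall>f\<in>ell2 (F_omega n \<omega>). orth_proj M (T i f) = T i (orth_proj M f)"
    using M subset_wot_algebra[of "T ` letters n" "F_omega n \<omega>"]
    unfolding reduces_def shift_algebra_def by blast
  note step = proj_entry_step[OF closed commutes]
    and weight = weight_eq_if_proj_entry[OF closed commutes]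
    and range = proj_entry_range[OF closed commutes]
  \<comment> \<open>Letters are removed one by one: \<open>range\<close> and
    \<open>lmul_letter_eq\<close> force the first letters to agree, and \<open>step\<close> passes
    to the parents.\<close>
  have strip: "y = y' \<and> proj_entry M (el [] m) (el [] m') \<noteq> 0"
    if "length y = length y'" "y \<in> free_semigroup n" "y' \<in> free_semigroup n"
      "proj_entry M (el y m) (el y' m') \<noteq> 0" for y y' m m'
    using that
  proof (induction y y' rule: list_induct2)
    case (Cons i y j y')
    then have ij: "i \<in> letters n" "j \<in> letters n" "y \<in> free_semigroup n" "y' \<in> free_semigroup n"
      by auto
    then have F: "el y m \<in> F_omega n \<omega>" "el y' m' \<in> F_omega n \<omega>" by (auto intro: el_in_F)
    have nz: "proj_entry M (lmul n i (el y m)) (lmul n j (el y' m')) \<noteq> 0"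
      using Cons.prems ij by (simp add: lmul_el)
    then obtain u where "u \<in> F_omega n \<omega>" "lmul n i (el y m) = lmul n j u"
      using range[OF ij(2) F(2)] by blast
    then have "i = j" using lmul_letter_eq ij F by blast
    then have "proj_entry M (el y m) (el y' m') \<noteq> 0" using nz step[OF ij(1) F] by simp
    then show ?case using Cons.IH ij \<open>i = j\<close> by blast
  qed simp
  \<comment> \<open>The parent of the inverse of a prefix is the inverse of the next longer
    prefix.\<close>
  have el_Nil: "el [] m = lmul n (\<omega> !! m) (el [] (Suc m))" for m
    using lmul_el[OF letter_in, of "[]"] el_snoc[of "[]" m] by simp
  have Nil_F: "el [] m \<in> F_omega n \<omega>" for m by (simp add: el_in_F)
  have diag: "proj_entry M u u = proj_entry M (el [] 0) (el [] 0)" if u: "u \<in> F_omega n \<omega>" for u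
  proof -
    have Nil: "proj_entry M (el [] m) (el [] m) = proj_entry M (el [] 0) (el [] 0)" for m
    proof (induction m)
      case (Suc m)
      then show ?case using step[OF letter_in Nil_F Nil_F, of m "Suc m" "Suc m"] by (simp flip: el_Nil)
    qed simp
    obtain y m where y: "y \<in> free_semigroup n" "u = el y m" using u by (auto simp: F_omega_eq)
    have "proj_entry M (el y m) (el y m) = proj_entry M (el [] m) (el [] m)"
      using y(1)
    proof (induction y)
      case (Cons i y)
      then have i: "i \<in> letters n" "y \<in> free_semigroup n" by auto
      then show ?case
        using Cons step[OF i(1) el_in_F[OF i(2)] el_in_F[OF i(2)]] by (simp add: lmul_el)
    qed simp
    then show ?thesis using Nil y by simp
  qed
  obtain u v where uv: "u \<in> F_omega n \<omega>" "v \<in> F_omega n \<omega>" "u \<noteq> v" "proj_entry M u v \<noteq> 0"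
    using trivial_if_proj_entry_scalar[OF closed commutes _ diag] nontrivial by blast
  obtain y m where y: "y \<in> free_semigroup n" "u = el y m" using uv(1) by (auto simp: F_omega_eq)
  \<comment> \<open>A long enough word for \<open>v\<close> is chosen so that \<open>y\<close> can
    be extended along \<open>\<omega>\<close> to the same length, as \<open>strip\<close>
    requires.\<close>
  obtain z p where z: "length y \<le> length z" "z \<in> free_semigroup n" "v = el z p"
    by (rule F_omegaE[OF uv(2), of "length y"], rule that)
  define q where "q = m + (length z - length y)"
  let ?y = "y @ stake (length z - length y) (sdrop m \<omega>)"
  have y': "?y \<in> free_semigroup n" "length ?y = length z"
    using y z stake_in[of "length z - length y" m] by auto
  have u: "u = el ?y q" unfolding q_def y(2) by (rule el_extend[OF y(1), symmetric])
  have "?y = z" "proj_entry M (el [] q) (el [] p) \<noteq> 0"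
    using strip[OF y'(2,1) z(2), of q p] uv(4) u z(3) by auto
  \<comment> \<open>The two words coincide, so the distinct elements \<open>u\<close> and
    \<open>v\<close> must differ in their indices.\<close>
  moreover from this have "q \<noteq> p" using uv(3) u z(3) by auto
  ultimately obtain a b where ab: "a < b" "proj_entry M (el [] a) (el [] b) \<noteq> 0"
    using proj_entry_cnj[OF closed Nil_F Nil_F, of q p] by (metis complex_cnj_zero linorder_neqE_nat)
  \<comment> \<open>Nonzero entries persist along the chain of ancestors; \<open>up\<close> then
    carries them to all descendants.\<close>
  have forward: "proj_entry M (el [] (a + j)) (el [] (b + j)) \<noteq> 0" for j
  proof (induction j)
    case (Suc j)
    have "el [] (a + j) = el [\<omega> !! (a + j)] (Suc (a + j))" "el [] (b + j) = el [\<omega> !! (b + j)] (Suc (b + j))"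
      using el_snoc[of "[]"] by simp_all
    then have "proj_entry M (el [\<omega> !! (a + j)] (Suc (a + j))) (el [\<omega> !! (b + j)] (Suc (b + j))) \<noteq> 0"
      using Suc by simp
    then show ?case using strip[of "[\<omega> !! (a + j)]" "[\<omega> !! (b + j)]"] letter_in by simp
  qed (use ab in simp)
  have up: "proj_entry M (el y (a + j)) (el y (b + j)) \<noteq> 0" if "y \<in> free_semigroup n" for y j
    using that
  proof (induction y)
    case (Cons i y)
    then have i: "i \<in> letters n" "y \<in> free_semigroup n" by auto
    then show ?case using Cons step[OF i(1) el_in_F[OF i(2)] el_in_F[OF i(2)]] by (simp add: lmul_el)
  qed (use forward in simp)
  \<comment> \<open>Equality of weights is obtained at children of a pair with nonzero entry, whence
    the nonempty word; the chain starts at \<open>a\<close>, whence the bound on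
    \<open>m\<close>.\<close>
  show ?thesis
  proof (rule that[of "b - a" a])
    show "0 < b - a" using ab by simp
    fix x m assume x: "x \<in> free_semigroup n" "x \<noteq> []" "a \<le> m"
    then obtain i y where i: "x = i # y" "i \<in> letters n" "y \<in> free_semigroup n" by (cases x) auto
    then have "proj_entry M (el y m) (el y (m + (b - a))) \<noteq> 0"
      using up[of y "m - a"] x(3) ab(1) by (simp add: add.commute)
    then have "\<Lambda> (lmul n i (el y m)) = \<Lambda> (lmul n i (el y (m + (b - a))))"
      using weight[OF i(2) el_in_F[OF i(3)] el_in_F[OF i(3)]] by blast
    then show "\<Lambda> (el x m) = \<Lambda> (el x (m + (b - a)))" using i by (simp add: lmul_el)
  qed
qed

end

section \<open>From periodic weights to a reducing subspace\<close>

context periodic_infinite_word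
begin

lemma weights_of_period_imp_reducing:
  assumes shift: "weighted_tree_shift (F_omega n \<omega>) (letters n) (lmul n) \<Lambda> T"
    and period: "weights_of_period n \<omega> v0 k \<Lambda>"
  shows "has_nontrivial_reducing_subspace (F_omega n \<omega>) (shift_algebra n \<omega> T)"
proof -
  interpret weighted_tree_shift "F_omega n \<omega>" "letters n" "lmul n" \<Lambda> T by (rule shift)
  interpret periodic_tree_shift "F_omega n \<omega>" "letters n" "lmul n" \<Lambda> T act
  proof
    show "\<Lambda> (act l (lmul n i u)) = \<Lambda> (lmul n i u)" if "i \<in> letters n" "u \<in> F_omega n \<omega>" for i u l
      using weight_act[OF period that] .
  qed (auto simp: act_in_F act_zero act_add act_lmul F_closed dest: act_free[OF F_closed])
  have "F_omega n \<omega> \<noteq> {}" using el_in_F[of "[]" 0] by auto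
  then show ?thesis unfolding shift_algebra_def by (rule reducing_subspace_exists)
qed

end

text \<open>Comparing the coefficients of the same basis vector turns each condition on the shift
  into the corresponding condition on the weights.\<close>

lemma shift_periodic_iff:
  assumes "weighted_shift n \<omega> \<Lambda> T"
  shows "shift_periodic n \<omega> \<Lambda> T \<longleftrightarrow> weights_periodic n \<omega> \<Lambda>"
proof -
  have "T i (ket v) = (\<lambda>x. of_real r * ket (lmul n i v) x) \<longleftrightarrow> \<Lambda> (lmul n i v) = r"
    if "v \<in> F_omega n \<omega>" "i \<in> letters n" for v i r
    using assms that by (auto simp: weighted_shift_def ket_apply fun_eq_iff)
  then show ?thesis
    unfolding shift_periodic_def weights_periodic_def shift_of_period_def weights_of_period_def
    by simp
qed

theorem theorem3p5:
  fixes n :: enat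
    and \<omega> :: "nat stream"
    and \<Lambda> :: "group_word \<Rightarrow> real"
    and T :: "nat \<Rightarrow> group_word operator"
  assumes "2 \<le> n"
    and "\<omega> \<in> streams (letters n)"
    and "periodic_word n \<omega>"
    and "\<forall>u\<in>F_omega n \<omega>. 0 < \<Lambda> u"
    and "weighted_shift n \<omega> \<Lambda> T"
  shows "(has_nontrivial_reducing_subspace (F_omega n \<omega>) (shift_algebra n \<omega> T)
            \<longleftrightarrow> weights_periodic n \<omega> \<Lambda>)
       \<and> (weights_periodic n \<omega> \<Lambda> \<longleftrightarrow> shift_periodic n \<omega> \<Lambda> T)"
proof (intro conjI iffI)
  interpret infinite_word n \<omega> by unfold_locales (rule assms(2))
  have shift: "weighted_tree_shift (F_omega n \<omega>) (letters n) (lmul n) \<Lambda> T"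
    using assms(4,5) by (rule weighted_tree_shift)
  show "weights_periodic n \<omega> \<Lambda>"
    if red: "has_nontrivial_reducing_subspace (F_omega n \<omega>) (shift_algebra n \<omega> T)"
  proof -
    obtain a d where d: "0 < d"
      and inv: "\<And>y m. y \<in> free_semigroup n \<Longrightarrow> y \<noteq> [] \<Longrightarrow> a \<le> m \<Longrightarrow> \<Lambda> (el y m) = \<Lambda> (el y (m + d))"
      by (rule reducing_imp_weights_invariant[OF shift red], rule that)
    obtain v where v: "primitive n v" "\<omega> = cycle v"
      by (rule periodic_word_primitive[OF assms(3)], rule that)
    \<comment> \<open>The invariance step \<open>d\<close> itself serves as the period, since
      \<open>d * length v\<close> is a multiple of it.\<close>
    interpret periodic_infinite_word n \<omega> v d
      using v d by unfold_locales (auto simp: primitive_def)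
    have inv': "\<Lambda> (el y m) = \<Lambda> (el y (m + j * d))" if "y \<in> free_semigroup n" "y \<noteq> []" "a \<le> m" for y m j
    proof (induction j)
      case (Suc j)
      then show ?case using inv[OF that(1,2), of "m + j * d"] that(3) by (simp add: algebra_simps)
    qed simp
    have "weights_of_period n \<omega> v d \<Lambda>"
    proof (rule weights_of_period_if)
      fix y m assume y: "y \<in> free_semigroup n"
      \<comment> \<open>Extending by \<open>a + 1\<close> letters of \<open>\<omega>\<close> leaves
        the element unchanged, makes the word nonempty and pushes the index past \<open>a\<close>.
        By periodicity the same letters extend the representation whose index is larger by
        \<open>d * length v\<close>.\<close>
      let ?s = "stake (Suc a) (sdrop m \<omega>)"
      have s: "?s = stake (Suc a) (sdrop (m + d * length v) \<omega>)"
        using sdrop_mult_length[of d] sdrop_add[of m "d * length v" \<omega>] by (simp add: add.commute)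
      have "\<Lambda> (el y m) = \<Lambda> (el (y @ ?s) (m + Suc a))" by (simp only: el_extend[OF y])
      also have "\<dots> = \<Lambda> (el (y @ ?s) (m + Suc a + length v * d))"
        using y stake_in[of "Suc a" m] by (intro inv') auto
      also have "\<dots> = \<Lambda> (el (y @ stake (Suc a) (sdrop (m + d * length v) \<omega>)) (m + d * length v + Suc a))"
        unfolding s[symmetric] by (simp add: algebra_simps)
      also have "\<dots> = \<Lambda> (el y (m + d * length v))" by (simp only: el_extend[OF y])
      finally show "\<Lambda> (el y m) = \<Lambda> (el y (m + d * length v))" .
    qed
    then show ?thesis
      unfolding weights_periodic_def using v d by (intro exI[of _ v] exI[of _ d] conjI) simp_all
  qed
  show "has_nontrivial_reducing_subspace (F_omega n \<omega>) (shift_algebra n \<omega> T)"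
    if "weights_periodic n \<omega> \<Lambda>"
  proof -
    obtain v k where v: "primitive n v" "\<omega> = cycle v" "1 \<le> k" "weights_of_period n \<omega> v k \<Lambda>"
      using \<open>weights_periodic n \<omega> \<Lambda>\<close> by (auto simp: weights_periodic_def)
    interpret periodic_infinite_word n \<omega> v k
      using v by unfold_locales (auto simp: primitive_def)
    show ?thesis by (rule weights_of_period_imp_reducing[OF shift v(4)])
  qed
qed (simp_all add: shift_periodic_iff[OF assms(5)])

end
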